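(* Let $\theta\in\mathbb{R}\setminus\{0\}$. Suppose that the backward Riccati recursion (given in the context) generating $P_t,\eta_t,\tilde P_{t+1},\tilde H_t,S_t$ is well-defined for $t=0,\ldots,N-1$ and satisfies $S_t\succ 0$ for all $t=0,\ldots,N-1$. In addition, assume that $$\Xi_t:=\Sigma_t^{-1}-2\theta\tilde H_t\succ 0\qquad\text{for all } t=0,\ldots,N-1.$$ Then the following hold. (1) The optimal nominal control law of the finite-horizon input-randomized risk-sensitive LQR problem $$\bar J^*=\min_{\bar u_{0:N-1}}\frac1\theta\log\mathbb{E}\left[e^{\theta L_0(x_{0:N},\,\bar u_{0:N-1}+e_{0:N-1})}\right]$$ subject to $x_{t+1}=A_tx_t+B_t(\bar u_t+e_t)+w_t$, $x_0=x^{\mathsf{ini}}$, takes the state feedback form $\bar u_t^*=\tilde K_tx_t$, where $$\tilde K_t=-\left(R_t+B_t^\top\tilde P_{t+1}B_t\right)^{-1}B_t^\top\tilde P_{t+1}A_t .$$ (2) The optimal cost-to-go function of this problem is $\bar V_t(x)=x^\top P_tx+\bar\eta_t$ for all $x\in\mathbb{R}^n$ and $t=0,1,\ldots,N$, where $\bar\eta_t$ is determined by the backward recursion $$\bar\eta_N=0,\qquad \bar\eta_t=\bar\eta_{t+1}-\frac{1}{2\theta}\log\left(|S_tW_t|\cdot|\Xi_t\Sigma_t|\right),\quad t=0,\ldots,N-1.$$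
   Context: Notation: $|A|$ is the determinant of a square matrix $A$; $\succ,\succeq$ denote the Loewner order on symmetric matrices; $v_{0:N}=[v_0^\top,\ldots,v_N^\top]^\top$; $\mathcal N(\mu,\Sigma)$ is the Gaussian distribution with mean $\mu$ and covariance $\Sigma$. Data: positive integers $n,m,N$; matrices $A_t\in\mathbb{R}^{n\times n}$, $B_t\in\mathbb{R}^{n\times m}$, symmetric $W_t\in\mathbb{R}^{n\times n}$ with $W_t\succ0$, $\Sigma_t\in\mathbb{R}^{m\times m}$ with $\Sigma_t\succ 0$, $R_t\in\mathbb{R}^{m\times m}$ with $R_t\succ0$ ($t=0,\ldots,N-1$), and $Q_t\in\mathbb{R}^{n\times n}$ with $Q_t\succeq0$ ($t=0,\ldots,N$); an initial state $x^{\mathsf{ini}}\in\mathbb{R}^n$. Noises: $w_t\sim\mathcal N(0,W_t)$ (process noise) and $e_t\sim\mathcal N(0,\Sigma_t)$ (input noise deliberately injected by the controller), $t=0,\ldots,N-1$, all mutually independent. The applied input is $u_t=\bar u_t+e_t$, where $\bar u_t$ is the nominal control input to be optimized. Nominal inputs are chosen causally: $\bar u_t\in\mathbb{R}^m$ is a (measurable) function of the state history $x_0,\ldots,x_t$ and is determined before $e_t$ and $w_t$ are realized. An expectation equal to $+\infty$ (possible for $\theta>0$) is treated as infinite cost. Cost: for $t=0,\ldots,N-1$, $L_t(x_{t:N},u_{t:N-1}):=x_N^\top Q_Nx_N+\sum_{k=t}^{N-1}\left(x_k^\top Q_kx_k+u_k^\top R_ku_k\right)$. Optimal cost-to-go: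 $\bar V_N(x):=x^\top Q_Nx$ and, for $t=0,\ldots,N-1$, $$\bar V_t(x):=\min_{\bar u_{t:N-1}}\frac1\theta\log\mathbb{E}\left[e^{\theta L_t(x_{t:N},\,\bar u_{t:N-1}+e_{t:N-1})}\,\middle|\,x_t=x\right].$$ Backward Riccati recursion (for the given $\theta$): $P_N=Q_N$, $\eta_N=0$, and for $t=N-1,\ldots,0$, $$S_t=W_t^{-1}-2\theta P_{t+1},\qquad \tilde P_{t+1}=P_{t+1}+2\theta P_{t+1}S_t^{-1}P_{t+1},\qquad \tilde H_t=R_t+B_t^\top\tilde P_{t+1}B_t,$$ $$P_t=Q_t+A_t^\top\tilde P_{t+1}A_t-A_t^\top\tilde P_{t+1}B_t\tilde H_t^{-1}B_t^\top\tilde P_{t+1}A_t,\qquad \eta_t=\eta_{t+1}-\frac{1}{2\theta}\log|S_tW_t|.$$ It is well-defined if all the inverses and logarithms occurring in it exist. *)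

theory Defs
  imports "HOL-Probability.Probability"
begin

definition pos_def :: "real^'n^'n \<Rightarrow> bool" where
  "pos_def A \<longleftrightarrow> transpose A = A \<and> (\<forall>x. x \<noteq> 0 \<longrightarrow> 0 < x \<bullet> (A *v x))"

definition pos_semidef :: "real^'n^'n \<Rightarrow> bool" where
  "pos_semidef A \<longleftrightarrow> transpose A = A \<and> (\<forall>x. 0 \<le> x \<bullet> (A *v x))"

(* Nondegenerate Gaussian; only meaningful for a positive definite covariance C. *)
definition gaussian_density :: "real^'n \<Rightarrow> real^'n^'n \<Rightarrow> real^'n \<Rightarrow> real" where
  "gaussian_density \<mu> C x =
     exp (- ((x - \<mu>) \<bullet> (matrix_inv C *v (x - \<mu>))) / 2) / sqrt ((2 * pi) ^ CARD('n) * det C)"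

definition has_gaussian_law :: "'a measure \<Rightarrow> ('a \<Rightarrow> real^'n) \<Rightarrow> real^'n \<Rightarrow> real^'n^'n \<Rightarrow> bool" where
  "has_gaussian_law M X \<mu> C \<longleftrightarrow> distributed M lborel X (\<lambda>x. ennreal (gaussian_density \<mu> C x))"

(* w_0, ..., w_{N-1}, e_0, ..., e_{N-1} are mutually independent.  The two families have different
   value types, so independence is expressed through the generated sigma-algebras (as in the
   definition of indep_vars), indexed by the disjoint sum {..<N} <+> {..<N}. *)
definition indep_noises ::
  "'a measure \<Rightarrow> nat \<Rightarrow> (nat \<Rightarrow> 'a \<Rightarrow> real^'n) \<Rightarrow> (nat \<Rightarrow> 'a \<Rightarrow> real^'m) \<Rightarrow> bool" where
  "indep_noises M N w e \<longleftrightarrow>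
     prob_space.indep_sets M
       (case_sum (\<lambda>t. {w t -` D \<inter> space M |D. D \<in> sets borel})
                 (\<lambda>t. {e t -` D \<inter> space M |D. D \<in> sets borel}))
       ({..<N} <+> {..<N})"

(* A policy maps a time k and the state history (x_0, ..., x_k), an extensional function on {..k},
   to the nominal input at time k. *)
type_synonym ('n, 'm) policy = "nat \<Rightarrow> (nat \<Rightarrow> real^'n) \<Rightarrow> real^'m"

definition admissible :: "nat \<Rightarrow> ('n::finite, 'm::finite) policy \<Rightarrow> bool" where
  "admissible N \<pi> \<longleftrightarrow> (\<forall>k<N. \<pi> k \<in> measurable (PiM {..k} (\<lambda>_. borel)) borel)"

lemma restrict_fundef_cong [fundef_cong]:
  "I = J \<Longrightarrow> (\<And>i. i \<in> J \<Longrightarrow> f i = g i) \<Longrightarrow> restrict f I = restrict g J"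
  by (auto simp: restrict_def)

(* State x_k for the noise realisation e, w when the states up to time t are prescribed to be
   h 0, ..., h t and the dynamics is run under the policy \<pi> from time t on. *)
fun state ::
  "(nat \<Rightarrow> real^'n^'n) \<Rightarrow> (nat \<Rightarrow> real^'m^'n) \<Rightarrow> ('n::finite, 'm::finite) policy \<Rightarrow>
   (nat \<Rightarrow> real^'m) \<Rightarrow> (nat \<Rightarrow> real^'n) \<Rightarrow> nat \<Rightarrow> (nat \<Rightarrow> real^'n) \<Rightarrow> nat \<Rightarrow> real^'n" where
  "state A B \<pi> e w t h 0 = h 0"
| "state A B \<pi> e w t h (Suc k) =
     (if Suc k \<le> t then h (Suc k)
      else A k *v state A B \<pi> e w t h k
           + B k *v (\<pi> k (\<lambda>i\<in>{..k}. state A B \<pi> e w t h i) + e k) + w k)"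

(* The applied input: nominal input plus injected noise. *)
definition input ::
  "(nat \<Rightarrow> real^'n^'n) \<Rightarrow> (nat \<Rightarrow> real^'m^'n) \<Rightarrow> ('n::finite, 'm::finite) policy \<Rightarrow>
   (nat \<Rightarrow> real^'m) \<Rightarrow> (nat \<Rightarrow> real^'n) \<Rightarrow> nat \<Rightarrow> (nat \<Rightarrow> real^'n) \<Rightarrow> nat \<Rightarrow> real^'m" where
  "input A B \<pi> e w t h k = \<pi> k (\<lambda>i\<in>{..k}. state A B \<pi> e w t h i) + e k"

definition cost_from ::
  "nat \<Rightarrow> (nat \<Rightarrow> real^'n^'n) \<Rightarrow> (nat \<Rightarrow> real^'m^'m) \<Rightarrow> nat \<Rightarrow>
   (nat \<Rightarrow> real^'n) \<Rightarrow> (nat \<Rightarrow> real^'m) \<Rightarrow> real" where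
  "cost_from N Q R t x u =
     x N \<bullet> (Q N *v x N) + (\<Sum>k=t..<N. x k \<bullet> (Q k *v x k) + u k \<bullet> (R k *v u k))"

(* E[exp (\<theta> L_t) | x_0 = h 0, ..., x_t = h t] under the policy \<pi>. *)
definition exp_cost ::
  "'a measure \<Rightarrow> nat \<Rightarrow> real \<Rightarrow>
   (nat \<Rightarrow> real^'n^'n) \<Rightarrow> (nat \<Rightarrow> real^'m^'n) \<Rightarrow> (nat \<Rightarrow> real^'n^'n) \<Rightarrow> (nat \<Rightarrow> real^'m^'m) \<Rightarrow>
   (nat \<Rightarrow> 'a \<Rightarrow> real^'n) \<Rightarrow> (nat \<Rightarrow> 'a \<Rightarrow> real^'m) \<Rightarrow>
   nat \<Rightarrow> (nat \<Rightarrow> real^'n) \<Rightarrow> ('n::finite, 'm::finite) policy \<Rightarrow> ennreal" where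
  "exp_cost M N \<theta> A B Q R w e t h \<pi> =
     (\<integral>\<^sup>+\<omega>. ennreal (exp (\<theta> * cost_from N Q R t
         (state A B \<pi> (\<lambda>k. e k \<omega>) (\<lambda>k. w k \<omega>) t h)
         (input A B \<pi> (\<lambda>k. e k \<omega>) (\<lambda>k. w k \<omega>) t h))) \<partial>M)"

definition log_ennreal :: "ennreal \<Rightarrow> ereal" where
  "log_ennreal z =
     (if z = 0 then - \<infinity> else if z = \<infinity> then \<infinity> else ereal (ln (enn2real z)))"

definition log_risk :: "real \<Rightarrow> ennreal \<Rightarrow> ereal" where
  "log_risk \<theta> z = ereal (1 / \<theta>) * log_ennreal z"

(* The objective of the finite-horizon problem with initial state xini. *)
definition total_risk ::
  "'a measure \<Rightarrow> nat \<Rightarrow> real \<Rightarrow>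
   (nat \<Rightarrow> real^'n^'n) \<Rightarrow> (nat \<Rightarrow> real^'m^'n) \<Rightarrow> (nat \<Rightarrow> real^'n^'n) \<Rightarrow> (nat \<Rightarrow> real^'m^'m) \<Rightarrow>
   (nat \<Rightarrow> 'a \<Rightarrow> real^'n) \<Rightarrow> (nat \<Rightarrow> 'a \<Rightarrow> real^'m) \<Rightarrow>
   real^'n \<Rightarrow> ('n::finite, 'm::finite) policy \<Rightarrow> ereal" where
  "total_risk M N \<theta> A B Q R w e xini \<pi> =
     log_risk \<theta> (exp_cost M N \<theta> A B Q R w e 0 (\<lambda>_. xini) \<pi>)"

(* (1/\<theta>) log E[exp (\<theta> L_t) | x_t = x].  A policy may use the states before time t as
   well, so the conditional expectation depends on their conditional law \<nu> given x_t = x,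
   which is determined by the inputs applied before time t.  The noises from time t on are
   independent of that past, whence the product form. *)
definition risk_to_go ::
  "'a measure \<Rightarrow> nat \<Rightarrow> real \<Rightarrow>
   (nat \<Rightarrow> real^'n^'n) \<Rightarrow> (nat \<Rightarrow> real^'m^'n) \<Rightarrow> (nat \<Rightarrow> real^'n^'n) \<Rightarrow> (nat \<Rightarrow> real^'m^'m) \<Rightarrow>
   (nat \<Rightarrow> 'a \<Rightarrow> real^'n) \<Rightarrow> (nat \<Rightarrow> 'a \<Rightarrow> real^'m) \<Rightarrow>
   nat \<Rightarrow> (nat \<Rightarrow> real^'n) measure \<Rightarrow> real^'n \<Rightarrow> ('n::finite, 'm::finite) policy \<Rightarrow> ereal" where
  "risk_to_go M N \<theta> A B Q R w e t \<nu> x \<pi> =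
     log_risk \<theta> (\<integral>\<^sup>+h. exp_cost M N \<theta> A B Q R w e t (h(t := x)) \<pi> \<partial>\<nu>)"

definition past_law :: "nat \<Rightarrow> (nat \<Rightarrow> real^'n) measure \<Rightarrow> bool" where
  "past_law t \<nu> \<longleftrightarrow> prob_space \<nu> \<and> sets \<nu> = sets (PiM {..<t} (\<lambda>_. borel))"

(* The optimal cost-to-go, as an infimum; that it is attained is a separate claim. *)
definition cost_to_go ::
  "'a measure \<Rightarrow> nat \<Rightarrow> real \<Rightarrow>
   (nat \<Rightarrow> real^'n^'n) \<Rightarrow> (nat \<Rightarrow> real^'m^'n) \<Rightarrow> (nat \<Rightarrow> real^'n^'n) \<Rightarrow> (nat \<Rightarrow> real^'m^'m) \<Rightarrow>
   (nat \<Rightarrow> 'a \<Rightarrow> real^'n) \<Rightarrow> (nat \<Rightarrow> 'a \<Rightarrow> real^'m) \<Rightarrow>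
   nat \<Rightarrow> (nat \<Rightarrow> real^'n) measure \<Rightarrow> real^'n \<Rightarrow> ereal" where
  "cost_to_go M N \<theta> A B Q R w e t \<nu> x =
     (if t = N then ereal (x \<bullet> (Q N *v x))
      else (INF \<pi>\<in>Collect (admissible N). risk_to_go M N \<theta> A B Q R w e t \<nu> x \<pi>))"

definition riccati_recursion ::
  "nat \<Rightarrow> real \<Rightarrow>
   (nat \<Rightarrow> real^'n^'n) \<Rightarrow> (nat \<Rightarrow> real^'m^'n) \<Rightarrow> (nat \<Rightarrow> real^'n^'n) \<Rightarrow>
   (nat \<Rightarrow> real^'n^'n) \<Rightarrow> (nat \<Rightarrow> real^'m^'m) \<Rightarrow>
   (nat \<Rightarrow> real^'n^'n) \<Rightarrow> (nat \<Rightarrow> real) \<Rightarrow> (nat \<Rightarrow> real^'n^'n) \<Rightarrow> (nat \<Rightarrow> real^'n^'n) \<Rightarrow>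
   (nat \<Rightarrow> real^'m^'m) \<Rightarrow> bool" where
  "riccati_recursion N \<theta> A B W Q R P \<eta> S Pt H \<longleftrightarrow>
     P N = Q N \<and> \<eta> N = 0 \<and>
     (\<forall>t<N.
        S t = matrix_inv (W t) - (2 * \<theta>) *\<^sub>R P (Suc t) \<and>
        Pt (Suc t) = P (Suc t) + (2 * \<theta>) *\<^sub>R (P (Suc t) ** matrix_inv (S t) ** P (Suc t)) \<and>
        H t = R t + transpose (B t) ** Pt (Suc t) ** B t \<and>
        P t = Q t + transpose (A t) ** Pt (Suc t) ** A t
              - transpose (A t) ** Pt (Suc t) ** B t ** matrix_inv (H t)
                ** transpose (B t) ** Pt (Suc t) ** A t \<and>
        \<eta> t = \<eta> (Suc t) - 1 / (2 * \<theta>) * ln (det (S t ** W t)))"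

(* All inverses and logarithms in the recursion exist. *)
definition riccati_well_defined ::
  "nat \<Rightarrow> (nat \<Rightarrow> real^'n^'n) \<Rightarrow> (nat \<Rightarrow> real^'n^'n) \<Rightarrow> (nat \<Rightarrow> real^'m^'m) \<Rightarrow> bool" where
  "riccati_well_defined N W S H \<longleftrightarrow>
     (\<forall>t<N. invertible (W t) \<and> invertible (S t) \<and> invertible (H t) \<and> 0 < det (S t ** W t))"

definition feedback_policy :: "(nat \<Rightarrow> real^'n^'m) \<Rightarrow> ('n::finite, 'm::finite) policy" where
  "feedback_policy K = (\<lambda>t x. K t *v x t)"

end

theory Submission
  imports Defs
begin

text \<open>
The proof is a verification argument: the candidate \<open>V\<^sub>k(x) = x \<bullet> P\<^sub>k x + \<eta>bar\<^sub>k\<close> is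
followed along the trajectory of an arbitrary policy, forward in time.

Fix a time \<open>t\<close>, a prescribed state history up to \<open>t\<close>, and an admissible policy. Put \<open>Y\<^sub>k
= exp (\<theta> (stage costs from t to k-1, plus V\<^sub>k(x\<^sub>k)))\<close>. Given the noises before \<open>k\<close>, the
next \<open>Y\<close> depends on the fresh pair \<open>(e\<^sub>k, w\<^sub>k)\<close> only through a quadratic exponent, so
the conditional expectation is a pair of Gaussian integrals. Integrating \<open>w\<^sub>k\<close> turns
\<open>P\<^sub>k\<^sub>+\<^sub>1\<close> into the risk-adjusted matrix (convergence is exactly \<open>S\<^sub>k > 0\<close>) and produces
\<open>det (S\<^sub>k W\<^sub>k)\<close>; completing the square in the applied input turns the exponent into \<open>x \<bullet>
P\<^sub>k x + (z + e) \<bullet> H\<^sub>k (z + e)\<close> with \<open>z = ubar\<^sub>k - K\<^sub>k x\<^sub>k\<close>; integrating \<open>e\<^sub>k\<close>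
(convergence is exactly \<open>\<Xi>\<^sub>k > 0\<close>) produces \<open>det (\<Xi>\<^sub>k \<Sigma>\<^sub>k)\<close> and a second risk-adjusted
matrix, the penalty \<open>D\<^sub>k\<close>. The two determinants are what \<open>\<eta>bar\<close> absorbs, and the result
is \<open>E Y\<^sub>k\<^sub>+\<^sub>1 = E (Y\<^sub>k exp (\<theta> z \<bullet> D\<^sub>k z))\<close> (lemma \<open>exp_value_step\<close>).

Since \<open>D\<^sub>k\<close> is positive semidefinite, \<open>E Y\<^sub>k\<close> increases in \<open>k\<close> for \<open>\<theta> > 0\<close> and decreases
for \<open>\<theta> < 0\<close>, and it is constant under the feedback \<open>z = 0\<close>. It starts at \<open>exp (\<theta>
V\<^sub>t(x\<^sub>t))\<close> and ends at the exponential cost. Because \<open>(1/\<theta>) log\<close> is monotone or antitone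
according to the sign of \<open>\<theta>\<close>, both cases say that no policy beats \<open>V\<^sub>t(x\<^sub>t)\<close> and that
the feedback attains it. The bound holds for every prescribed history, so averaging over
the past changes nothing.

Two inputs need work of their own. Positivity of the risk-adjusted matrices is delicate
for \<open>\<theta> < 0\<close>, where they are smaller than the original ones; it comes from reading the
completed square at its own centre (lemma \<open>pos_semidef_risk_adjusted\<close>). The Gaussian
integral with a general positive definite matrix needs the change of variables under an
invertible matrix over an arbitrary finite index type; it is proved by factoring into
elementary matrices.
\<close>

section \<open>Positive definite matrices\<close>

lemma matrix_inv_mult:
  assumes "invertible A"
  shows "A ** matrix_inv A = mat 1" "matrix_inv A ** A = mat 1"
  using assms someI_ex[of "\<lambda>B. A ** B = mat 1 \<and> B ** A = mat 1"]
  unfolding invertible_def matrix_inv_def by auto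

lemma matrix_inv_cancel:
  assumes "invertible A"
  shows "A *v (matrix_inv A *v x) = x" "matrix_inv A *v (A *v x) = x"
  by (simp_all add: matrix_vector_mul_assoc matrix_inv_mult[OF assms])

lemma inner_transpose:
  fixes A :: "real^'n^'m"
  shows "x \<bullet> (A *v y) = (transpose A *v x) \<bullet> y"
  by (simp add: dot_lmul_matrix[symmetric] vector_transpose_matrix)

lemma inner_symmetric:
  fixes A :: "real^'n^'n"
  assumes "transpose A = A"
  shows "x \<bullet> (A *v y) = y \<bullet> (A *v x)"
  using inner_transpose[of x A y] assms by (simp add: inner_commute)

lemma transpose_add: "transpose (A + B) = transpose A + transpose B"
  by (simp add: transpose_def vec_eq_iff)

lemma transpose_diff:
  fixes A B :: "'a::ab_group_add^'n^'m"
  shows "transpose (A - B) = transpose A - transpose B"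
  by (simp add: transpose_def vec_eq_iff)

lemma transpose_scaleR: "transpose (c *\<^sub>R A) = c *\<^sub>R transpose (A :: real^'n^'m)"
  by (simp add: transpose_def vec_eq_iff)

lemma matrix_vector_mult_minus: "A *v (- x) = - (A *v (x :: real^'n))"
  by (rule linear_neg) simp

lemma minus_matrix_vector_mult: "(- A) *v x = - (A *v (x :: real^'n))"
  by (simp add: matrix_vector_mult_def vec_eq_iff sum_negf)

lemma invertible_pos_def: "pos_def A \<Longrightarrow> invertible A"
  unfolding invertible_left_inverse matrix_left_invertible_ker pos_def_def
  by (metis inner_zero_right less_irrefl)

lemma transpose_matrix_inv:
  fixes A :: "real^'n^'n"
  assumes "invertible A" "transpose A = A"
  shows "transpose (matrix_inv A) = matrix_inv A"
proof -
  have "transpose (matrix_inv A) ** A = mat 1"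
    using matrix_inv_mult(1)[OF assms(1)] matrix_transpose_mul[of A "matrix_inv A"] assms(2)
    by simp
  then show ?thesis
    by (metis assms(1) matrix_inv_mult(1) matrix_mul_assoc matrix_mul_lid matrix_mul_rid)
qed

lemma pos_def_matrix_inv:
  assumes "pos_def A"
  shows "pos_def (matrix_inv A)"
proof -
  have inv: "invertible A" and sym: "transpose A = A"
    using assms invertible_pos_def by (auto simp: pos_def_def)
  have "0 < x \<bullet> (matrix_inv A *v x)" if "x \<noteq> 0" for x
  proof -
    have "matrix_inv A *v x \<noteq> 0"
      using that matrix_inv_cancel(1)[OF inv, of x] by force
    then have "0 < (matrix_inv A *v x) \<bullet> (A *v (matrix_inv A *v x))"
      using assms by (simp add: pos_def_def)
    then show ?thesis
      by (simp add: matrix_inv_cancel[OF inv] inner_commute)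
  qed
  then show ?thesis
    by (simp add: pos_def_def transpose_matrix_inv[OF inv sym])
qed

lemma pos_semidef_if_pos_def: "pos_def A \<Longrightarrow> pos_semidef A"
  unfolding pos_def_def pos_semidef_def by (metis inner_zero_left less_imp_le order_refl)

lemma pos_def_add_pos_semidef: "pos_def A \<Longrightarrow> pos_semidef B \<Longrightarrow> pos_def (A + B)"
  by (simp add: pos_def_def pos_semidef_def transpose_add matrix_vector_mult_add_rdistrib
      inner_add_right add_pos_nonneg)

lemma pos_semidef_congruence:
  assumes "pos_semidef A"
  shows "pos_semidef (transpose B ** A ** B)"
proof -
  have "x \<bullet> ((transpose B ** A ** B) *v x) = (B *v x) \<bullet> (A *v (B *v x))" for x
    using inner_transpose[of x "transpose B" "A *v (B *v x)"]
    by (simp add: matrix_vector_mul_assoc[symmetric])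
  with assms show ?thesis
    by (simp add: pos_semidef_def matrix_transpose_mul matrix_mul_assoc)
qed

section \<open>Completing squares\<close>

text \<open>
The quadratic form that replaces \<open>G\<close> in the exponent after a Gaussian disturbance has
been integrated out. The matrix \<open>S\<close> is the precision of the disturbance under the tilted
law, that is, its own inverse covariance minus \<open>2\<theta>G\<close>.
\<close>

definition risk_adjusted :: "real \<Rightarrow> real^'n^'n \<Rightarrow> real^'n^'n \<Rightarrow> real^'n^'n" where
  "risk_adjusted \<theta> S G = G + (2 * \<theta>) *\<^sub>R (G ** matrix_inv S ** G)"

text \<open>
The exponent of a Gaussian density with precision \<open>C\<close>, tilted by \<open>exp (\<theta> G)\<close>, as a
function of the disturbance \<open>x\<close>: it is again Gaussian, with precision \<open>S\<close> and centre \<open>a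
y\<close>, and what is left over is the risk-adjusted form of \<open>y\<close>. The same identity yields
both the value of the Gaussian integral and the positivity of the risk-adjusted matrix.
\<close>

lemma complete_square_noise:
  fixes C G :: "real^'n^'n"
  assumes G: "transpose G = G" and S: "S = C - (2 * \<theta>) *\<^sub>R G" "transpose S = S" "invertible S"
  defines "a y \<equiv> (2 * \<theta>) *\<^sub>R (matrix_inv S *v (G *v y))"
  shows "\<theta> * ((y + x) \<bullet> (G *v (y + x))) - x \<bullet> (C *v x) / 2 =
    \<theta> * (y \<bullet> (risk_adjusted \<theta> S G *v y)) - (x - a y) \<bullet> (S *v (x - a y)) / 2"
proof -
  have C: "C = S + (2 * \<theta>) *\<^sub>R G" using S by simp
  have Sa: "S *v a y = (2 * \<theta>) *\<^sub>R (G *v y)"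
    unfolding a_def by (simp add: matrix_vector_mult_scaleR matrix_inv_cancel[OF S(3)])
  have aSx: "a y \<bullet> (S *v x) = x \<bullet> (S *v a y)"
    by (rule inner_symmetric[OF S(2)])
  have yGx: "y \<bullet> (G *v x) = x \<bullet> (G *v y)"
    by (rule inner_symmetric[OF G])
  have aGy: "a y \<bullet> (G *v y) = y \<bullet> (G *v a y)"
    by (rule inner_symmetric[OF G])
  have "y \<bullet> (risk_adjusted \<theta> S G *v y) = y \<bullet> (G *v y) + y \<bullet> (G *v a y)"
    unfolding risk_adjusted_def a_def
    by (simp add: matrix_vector_mult_add_rdistrib scaleR_matrix_vector_assoc[symmetric]
        matrix_vector_mul_assoc[symmetric] matrix_vector_mult_scaleR inner_add_right)
  moreover have "(y + x) \<bullet> (G *v (y + x)) = y \<bullet> (G *v y) + 2 * (x \<bullet> (G *v y)) + x \<bullet> (G *v x)"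
    using yGx by (simp add: matrix_vector_right_distrib inner_add_left inner_add_right)
  moreover have "x \<bullet> (C *v x) = x \<bullet> (S *v x) + 2 * \<theta> * (x \<bullet> (G *v x))"
    by (simp add: C matrix_vector_mult_add_rdistrib scaleR_matrix_vector_assoc[symmetric]
        inner_add_right)
  moreover have "(x - a y) \<bullet> (S *v (x - a y))
      = x \<bullet> (S *v x) - 4 * \<theta> * (x \<bullet> (G *v y)) + 2 * \<theta> * (y \<bullet> (G *v a y))"
    using aSx aGy
    by (simp add: matrix_vector_mult_diff_distrib inner_diff_left inner_diff_right Sa
        algebra_simps)
  ultimately show ?thesis
    by (simp add: field_simps)
qed

text \<open>
For \<open>\<theta> > 0\<close> the tilted exponent at \<open>x = 0\<close> shows that risk adjustment only enlarges \<open>G\<close>.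
For \<open>\<theta> < 0\<close> it shrinks \<open>G\<close>, and evaluating at the centre \<open>x = a\<close>, where the \<open>S\<close>-square
vanishes, exhibits \<open>\<theta>\<close> times the new form as a sum of two nonpositive terms.
\<close>

lemma pos_semidef_risk_adjusted:
  fixes C G :: "real^'n^'n"
  assumes "pos_def C" "pos_semidef G" "S = C - (2 * \<theta>) *\<^sub>R G" "pos_def S" "\<theta> \<noteq> 0"
  shows "pos_semidef (risk_adjusted \<theta> S G)"
proof -
  have G: "transpose G = G" "\<And>z. 0 \<le> z \<bullet> (G *v z)" using assms by (auto simp: pos_semidef_def)
  have S: "transpose S = S" "invertible S" using assms invertible_pos_def by (auto simp: pos_def_def)
  have nonneg: "0 \<le> z \<bullet> (S *v z)" "0 \<le> z \<bullet> (C *v z)" for z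
    using assms pos_semidef_if_pos_def by (auto simp: pos_semidef_def)
  note square = complete_square_noise[OF G(1) assms(3) S]
  have "0 \<le> y \<bullet> (risk_adjusted \<theta> S G *v y)" for y
  proof (cases "0 < \<theta>")
    case True
    define a where "a = (2 * \<theta>) *\<^sub>R (matrix_inv S *v (G *v y))"
    have "\<theta> * (y \<bullet> (G *v y)) = \<theta> * (y \<bullet> (risk_adjusted \<theta> S G *v y)) - (- a) \<bullet> (S *v (- a)) / 2"
      using square[of y 0] by (simp only: a_def diff_0 add_0_right inner_zero_left)
    moreover have "0 \<le> \<theta> * (y \<bullet> (G *v y))"
      using G(2) True by simp
    ultimately have "0 \<le> \<theta> * (y \<bullet> (risk_adjusted \<theta> S G *v y))"
      using nonneg(1)[of "- a"] by linarith
    with True show ?thesis by (simp add: zero_le_mult_iff)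
  next
    case False
    define a where "a = (2 * \<theta>) *\<^sub>R (matrix_inv S *v (G *v y))"
    have "\<theta> * (y \<bullet> (risk_adjusted \<theta> S G *v y)) \<le> 0"
    proof -
      have "\<theta> * ((y + a) \<bullet> (G *v (y + a))) - a \<bullet> (C *v a) / 2 =
          \<theta> * (y \<bullet> (risk_adjusted \<theta> S G *v y))"
        using square[of y a] unfolding a_def[symmetric] by simp
      moreover have "\<theta> * ((y + a) \<bullet> (G *v (y + a))) \<le> 0"
        using G(2) False by (simp add: mult_nonpos_nonneg)
      ultimately show ?thesis using nonneg(2)[of a] by linarith
    qed
    with False assms(5) show ?thesis by (simp add: mult_le_0_iff)
  qed
  then show ?thesis
    using G(1) transpose_matrix_inv[OF S(2,1)]
    by (simp add: pos_semidef_def risk_adjusted_def transpose_add transpose_scaleR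
        matrix_transpose_mul matrix_mul_assoc)
qed

text \<open>
The deterministic linear-quadratic step: among all applied inputs \<open>u\<close> the feedback \<open>K x\<close>
is the centre of the quadratic, and \<open>x \<bullet> P x\<close> is its value there.
\<close>

lemma complete_square_control:
  fixes A G :: "real^'n^'n" and B :: "real^'m^'n" and R H :: "real^'m^'m" and K :: "real^'n^'m"
  assumes G: "transpose G = G" and H: "H = R + transpose B ** G ** B"
      "transpose H = H" "invertible H"
    and K: "K = - (matrix_inv H ** transpose B ** G ** A)"
    and P: "P = Q + transpose A ** G ** A
                - transpose A ** G ** B ** matrix_inv H ** transpose B ** G ** A"
  shows "x \<bullet> (Q *v x) + u \<bullet> (R *v u) + (A *v x + B *v u) \<bullet> (G *v (A *v x + B *v u)) =
    x \<bullet> (P *v x) + (u - K *v x) \<bullet> (H *v (u - K *v x))"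
proof -
  define y where "y = A *v x"
  define k where "k = K *v x"
  define g where "g = transpose B *v (G *v y)"
  have k: "k = - (matrix_inv H *v g)"
    by (simp add: k_def K g_def y_def minus_matrix_vector_mult matrix_vector_mul_assoc matrix_mul_assoc)
  have Hk: "H *v k = - g"
    by (simp add: k matrix_vector_mult_minus matrix_inv_cancel[OF H(3)])
  have kHu: "k \<bullet> (H *v u) = u \<bullet> (H *v k)"
    by (rule inner_symmetric[OF H(2)])
  have Ru: "u \<bullet> (R *v u) = u \<bullet> (H *v u) - (B *v u) \<bullet> (G *v (B *v u))"
    using inner_transpose[of u "transpose B" "G *v (B *v u)"]
    by (simp add: H(1) matrix_vector_mult_add_rdistrib inner_add_right
        matrix_vector_mul_assoc[symmetric])
  have cross: "(B *v u) \<bullet> (G *v y) = u \<bullet> g"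
    using inner_transpose[of u "transpose B" "G *v y"] by (simp add: g_def)
  have cross': "y \<bullet> (G *v (B *v u)) = u \<bullet> g"
    using inner_symmetric[OF G, of y "B *v u"] cross by simp
  have yk: "x \<bullet> ((transpose A ** G ** B ** matrix_inv H ** transpose B ** G ** A) *v x) = - (k \<bullet> g)"
  proof -
    have "x \<bullet> (transpose A *v (G *v (B *v k))) = y \<bullet> (G *v (B *v k))"
      using inner_transpose[of x "transpose A" "G *v (B *v k)"] by (simp add: y_def)
    also have "\<dots> = (B *v k) \<bullet> (G *v y)" by (rule inner_symmetric[OF G])
    also have "\<dots> = k \<bullet> g"
      using inner_transpose[of k "transpose B" "G *v y"] by (simp add: g_def)
    finally have 1: "x \<bullet> (transpose A *v (G *v (B *v k))) = k \<bullet> g" .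
    have "(transpose A ** G ** B ** matrix_inv H ** transpose B ** G ** A) *v x
        = transpose A *v (G *v (B *v (- k)))"
      by (simp add: k g_def y_def matrix_vector_mul_assoc matrix_mul_assoc)
    also have "\<dots> = - (transpose A *v (G *v (B *v k)))"
      by (simp add: matrix_vector_mult_minus)
    finally show ?thesis using 1 by simp
  qed
  have "x \<bullet> (P *v x) = x \<bullet> (Q *v x) + y \<bullet> (G *v y) + k \<bullet> g"
    using inner_transpose[of x "transpose A" "G *v y"] yk
    by (simp add: P matrix_vector_mult_add_rdistrib matrix_vector_mult_diff_rdistrib
        inner_add_right inner_diff_right y_def matrix_vector_mul_assoc[symmetric])
  moreover have "(u - k) \<bullet> (H *v (u - k)) = u \<bullet> (H *v u) + 2 * (u \<bullet> g) - k \<bullet> g"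
    using kHu
    by (simp add: matrix_vector_mult_diff_distrib inner_diff_left inner_diff_right inner_add_right
        Hk)
  moreover have "(y + B *v u) \<bullet> (G *v (y + B *v u))
      = y \<bullet> (G *v y) + 2 * (u \<bullet> g) + (B *v u) \<bullet> (G *v (B *v u))"
    by (simp add: matrix_vector_right_distrib inner_add_left inner_add_right cross cross')
  ultimately show ?thesis
    unfolding y_def[symmetric] k_def[symmetric] by (simp add: Ru)
qed

text \<open>
Positivity is preserved by the recursion because \<open>x \<bullet> P x\<close> is itself a cost: by the
preceding square it equals the nonnegative one-step cost at \<open>u = K x\<close>.
\<close>

lemma pos_semidef_riccati_step:
  fixes A G :: "real^'n^'n" and B :: "real^'m^'n" and R H :: "real^'m^'m"
  assumes "pos_semidef G" "pos_semidef Q" "pos_def R"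
    and H: "H = R + transpose B ** G ** B"
    and P: "P = Q + transpose A ** G ** A
                - transpose A ** G ** B ** matrix_inv H ** transpose B ** G ** A"
  shows "pos_def H" "pos_semidef P"
proof -
  show pd: "pos_def H"
    unfolding H using assms(1,3) by (intro pos_def_add_pos_semidef pos_semidef_congruence)
  have G: "transpose G = G" and Hs: "transpose H = H" "invertible H" and Q: "transpose Q = Q"
    using assms pd invertible_pos_def by (auto simp: pos_def_def pos_semidef_def)
  define K where "K = - (matrix_inv H ** transpose B ** G ** A)"
  have "0 \<le> x \<bullet> (P *v x)" for x
  proof -
    define u where "u = K *v x"
    have "x \<bullet> (P *v x) =
      x \<bullet> (Q *v x) + u \<bullet> (R *v u) + (A *v x + B *v u) \<bullet> (G *v (A *v x + B *v u))"
      using complete_square_control[OF G H Hs K_def P, of x u] by (simp add: u_def)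
    then show ?thesis
      using assms(1,2) pos_semidef_if_pos_def[OF assms(3)] by (simp add: pos_semidef_def)
  qed
  then show "pos_semidef P"
    using G Q transpose_matrix_inv[OF Hs(2,1)]
    by (simp add: pos_semidef_def P transpose_add transpose_diff matrix_transpose_mul
        matrix_mul_assoc)
qed

section \<open>Lebesgue measure under invertible matrices\<close>

lemma matrix_entry: "M $ i $ j = axis i 1 \<bullet> (M *v axis j (1::real))"
  by (simp add: matrix_vector_mult_basis inner_axis' column_def)

text \<open>
Gram--Schmidt for the inner product \<open>(x, y) \<mapsto> x \<bullet> S y\<close>. The columns of \<open>L\<close> are an
orthonormal basis for it, first built as a sequence \<open>f 0, f 1, ...\<close> and then indexed by
the type \<open>'n\<close> through a bijection. Substituting \<open>x = L y\<close> reduces Gaussian integrals to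
the standard one.
\<close>

lemma pos_def_congruent_to_identity:
  fixes S :: "real^'n^'n"
  assumes "pos_def S"
  shows "\<exists>L::real^'n^'n. transpose L ** S ** L = mat 1"
proof -
  have sym: "transpose S = S" and pos: "\<And>x. x \<noteq> 0 \<Longrightarrow> 0 < x \<bullet> (S *v x)"
    using assms by (auto simp: pos_def_def)
  have "k \<le> CARD('n) \<Longrightarrow>
      \<exists>f::nat \<Rightarrow> real^'n. \<forall>i<k. \<forall>j<k. f i \<bullet> (S *v f j) = (if i = j then 1 else 0)" for k
  proof (induction k)
    case 0
    then show ?case by simp
  next
    case (Suc k)
    then obtain f :: "nat \<Rightarrow> real^'n"
      where f: "\<And>i j. i < k \<Longrightarrow> j < k \<Longrightarrow> f i \<bullet> (S *v f j) = (if i = j then 1 else 0)"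
      by auto
    \<comment> \<open>Fewer than \<open>CARD('n)\<close> vectors do not span, which leaves a vector to orthogonalise.\<close>
    have "dim (f ` {..<k}) \<le> k"
      using dim_le_card'[of "f ` {..<k}"] card_image_le[of "{..<k}" f] by simp
    then have "dim (f ` {..<k}) < dim (UNIV :: (real^'n) set)"
      using Suc.prems by simp
    then have "span (f ` {..<k}) \<noteq> UNIV"
      by (metis dim_span less_irrefl)
    then obtain y where y: "y \<notin> span (f ` {..<k})" by blast
    define z where "z = y - (\<Sum>i<k. (f i \<bullet> (S *v y)) *\<^sub>R f i)"
    have "(\<Sum>i<k. (f i \<bullet> (S *v y)) *\<^sub>R f i) \<in> span (f ` {..<k})"
      by (intro span_sum span_scale span_base) auto
    then have "z \<noteq> 0" using y unfolding z_def by auto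
    then have zz: "0 < z \<bullet> (S *v z)" by (rule pos)
    have fz: "f j \<bullet> (S *v z) = 0" if "j < k" for j
    proof -
      have "f j \<bullet> (S *v z) = f j \<bullet> (S *v y) - (\<Sum>i<k. (f i \<bullet> (S *v y)) * (f j \<bullet> (S *v f i)))"
        unfolding z_def
        by (simp add: matrix_vector_mult_diff_distrib inner_diff_right inner_sum_right
            linear_sum[OF matrix_vector_mul_linear] matrix_vector_mult_scaleR)
      also have "(\<Sum>i<k. (f i \<bullet> (S *v y)) * (f j \<bullet> (S *v f i)))
          = (\<Sum>i<k. if i = j then f i \<bullet> (S *v y) else 0)"
        by (intro sum.cong) (auto simp: f that)
      finally show ?thesis using that by simp
    qed
    define c where "c = 1 / sqrt (z \<bullet> (S *v z))"
    have c: "c * (c * (z \<bullet> (S *v z))) = 1"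
      using zz unfolding c_def by simp
    have zf: "z \<bullet> (S *v f j) = 0" if "j < k" for j
      using fz[OF that] inner_symmetric[OF sym] by metis
    have "(f(k := c *\<^sub>R z)) i \<bullet> (S *v (f(k := c *\<^sub>R z)) j) = (if i = j then 1 else 0)"
      if "i < Suc k" "j < Suc k" for i j
      using that f[of i j] fz[of i] zf[of j] c
      by (auto simp: less_Suc_eq matrix_vector_mult_scaleR)
    then show ?case by blast
  qed
  then obtain f :: "nat \<Rightarrow> real^'n"
    where f: "\<And>i j. i < CARD('n) \<Longrightarrow> j < CARD('n) \<Longrightarrow> f i \<bullet> (S *v f j) = (if i = j then 1 else 0)"
    by blast
  obtain h where h: "bij_betw h (UNIV :: 'n set) {..<CARD('n)}"
    using ex_bij_betw_finite_nat[of "UNIV :: 'n set"] by (auto simp: atLeast0LessThan)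
  have hlt: "h i < CARD('n)" and hinj: "h i = h j \<longleftrightarrow> i = j" for i j
    using h by (auto simp: bij_betw_def inj_on_def)
  define L :: "real^'n^'n" where "L = (\<chi> i j. f (h j) $ i)"
  have L: "L *v axis j 1 = f (h j)" for j
    by (simp add: matrix_vector_mult_basis column_def L_def vec_eq_iff)
  have "(transpose L ** S ** L) $ i $ j = (mat 1 :: real^'n^'n) $ i $ j" for i j
  proof -
    have "(transpose L ** S ** L) $ i $ j = f (h i) \<bullet> (S *v f (h j))"
      using inner_transpose[of "axis i 1" "transpose L" "S *v f (h j)"]
      by (simp add: matrix_entry matrix_vector_mul_assoc[symmetric] L)
    then show ?thesis by (simp add: f hlt hinj mat_def)
  qed
  then show ?thesis
    by (auto simp: vec_eq_iff)
qed

lemma measurable_matrix_vector_mult [measurable (raw)]: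
  fixes A :: "real^'n^'m"
  assumes "f \<in> borel_measurable M"
  shows "(\<lambda>x. A *v f x) \<in> borel_measurable M"
  using assms by (intro borel_measurable_continuous_on[where f = "(*v) A"])
    (auto intro: linear_continuous_on linear_linear[THEN iffD1])

text \<open>
By Fubini: along each line in direction \<open>b\<close> the map is a translation, because \<open>g\<close> is
constant on that line. Applied to a linear \<open>g\<close> this covers the row operations.
\<close>

lemma nn_integral_lborel_shear:
  fixes b :: "'a::euclidean_space" and g :: "'a \<Rightarrow> real" and f :: "'a \<Rightarrow> ennreal"
  assumes b: "b \<in> Basis" and g: "\<And>x t. g (x + t *\<^sub>R b) = g x"
    and [measurable]: "g \<in> borel_measurable borel" "f \<in> borel_measurable borel"
  shows "(\<integral>\<^sup>+x. f (x + g x *\<^sub>R b) \<partial>lborel) = (\<integral>\<^sup>+x. f x \<partial>lborel)"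
proof -
  interpret product_sigma_finite "\<lambda>_::'a. lborel :: real measure" ..
  define I where "I = Basis - {b}"
  have I: "finite I" "b \<notin> I" "insert b I = Basis"
    using b by (auto simp: I_def)
  have update: "(\<Sum>i\<in>Basis. (y(b := t)) i *\<^sub>R i) = (\<Sum>i\<in>I. y i *\<^sub>R i) + t *\<^sub>R b" for y t
  proof -
    have "(\<Sum>i\<in>I. (y(b := t)) i *\<^sub>R i) = (\<Sum>i\<in>I. y i *\<^sub>R i)"
      using I(2) by (intro sum.cong) auto
    then show ?thesis
      unfolding I(3)[symmetric] using I(1,2) by (simp add: add.commute)
  qed
  have split: "(\<integral>\<^sup>+x. h x \<partial>lborel) =
      (\<integral>\<^sup>+y. (\<integral>\<^sup>+t. h ((\<Sum>i\<in>I. y i *\<^sub>R i) + t *\<^sub>R b) \<partial>lborel) \<partial>(\<Pi>\<^sub>M i\<in>I. lborel))"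
    if [measurable]: "h \<in> borel_measurable borel" for h :: "'a \<Rightarrow> ennreal"
  proof -
    have "(\<integral>\<^sup>+x. h x \<partial>lborel)
        = (\<integral>\<^sup>+y. h (\<Sum>i\<in>Basis. y i *\<^sub>R i) \<partial>(\<Pi>\<^sub>M i\<in>insert b I. lborel))"
      unfolding I(3) by (subst lborel_eq) (simp add: nn_integral_distr)
    also have "\<dots> = (\<integral>\<^sup>+y. (\<integral>\<^sup>+t. h (\<Sum>i\<in>Basis. (y(b := t)) i *\<^sub>R i) \<partial>lborel)
        \<partial>(\<Pi>\<^sub>M i\<in>I. lborel))"
      by (rule product_nn_integral_insert[OF I(1,2)]) (simp add: I(3))
    also have "\<dots> = (\<integral>\<^sup>+y. (\<integral>\<^sup>+t. h ((\<Sum>i\<in>I. y i *\<^sub>R i) + t *\<^sub>R b) \<partial>lborel) \<partial>(\<Pi>\<^sub>M i\<in>I. lborel))"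
      by (simp only: update)
    finally show ?thesis .
  qed
  have shift: "(\<integral>\<^sup>+t. k (c + t) \<partial>lborel) = (\<integral>\<^sup>+t. k t \<partial>lborel)"
    if [measurable]: "k \<in> borel_measurable borel" for k :: "real \<Rightarrow> ennreal" and c
    using nn_integral_real_affine[of k 1 c] by simp
  have "(\<integral>\<^sup>+x. f (x + g x *\<^sub>R b) \<partial>lborel) =
      (\<integral>\<^sup>+y. (\<integral>\<^sup>+t. f ((\<Sum>i\<in>I. y i *\<^sub>R i) + (g (\<Sum>i\<in>I. y i *\<^sub>R i) + t) *\<^sub>R b) \<partial>lborel)
        \<partial>(\<Pi>\<^sub>M i\<in>I. lborel))"
  proof -
    have "p + t *\<^sub>R b + g (p + t *\<^sub>R b) *\<^sub>R b = p + (g p + t) *\<^sub>R b" for p t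
      unfolding g by (simp add: scaleR_add_left)
    then show ?thesis by (subst split) (simp_all only:, measurable)
  qed
  also have "\<dots> = (\<integral>\<^sup>+y. (\<integral>\<^sup>+t. f ((\<Sum>i\<in>I. y i *\<^sub>R i) + t *\<^sub>R b) \<partial>lborel)
        \<partial>(\<Pi>\<^sub>M i\<in>I. lborel))"
    by (intro nn_integral_cong shift) simp
  also have "\<dots> = (\<integral>\<^sup>+x. f x \<partial>lborel)"
    by (rule split[symmetric]) simp
  finally show ?thesis .
qed

lemma axis_in_Basis: "axis i (1::real) \<in> Basis"
  by (auto simp: Basis_vec_def)

lemma prod_Basis_cart: "(\<Prod>b\<in>(Basis :: (real^'n) set). F b) = (\<Prod>i\<in>UNIV. F (axis i 1))"
proof -
  have Basis: "(Basis :: (real^'n) set) = range (\<lambda>i. axis i 1)"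
    by (auto simp: Basis_vec_def)
  have "inj (\<lambda>i. axis i 1 :: real^'n)"
    by (simp add: inj_on_def axis_eq_axis)
  then show ?thesis
    unfolding Basis by (simp add: prod.reindex)
qed

lemma nn_integral_lborel_permute:
  fixes f :: "real^'n \<Rightarrow> ennreal"
  assumes p: "p permutes UNIV" and [measurable]: "f \<in> borel_measurable borel"
  shows "(\<integral>\<^sup>+x. f (\<chi> i. x $ p i) \<partial>lborel) = (\<integral>\<^sup>+x. f x \<partial>lborel)"
proof -
  define T where "T x = (\<chi> i. x $ p i)" for x :: "real^'n"
  define T' where "T' x = (\<chi> i. x $ inv p i)" for x :: "real^'n"
  have T[measurable]: "T \<in> borel_measurable borel"
    unfolding T_def[abs_def]
    by (intro borel_measurable_continuous_onI continuous_intros)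
  have "lborel = distr lborel borel T"
  proof (rule lborel_eqI)
    fix l u :: "real^'n"
    assume le: "\<And>b. b \<in> Basis \<Longrightarrow> l \<bullet> b \<le> u \<bullet> b"
    have "T -` box l u = box (T' l) (T' u)"
      using permutes_inverses[OF p] by (auto simp: T_def T'_def mem_box_cart) metis+
    moreover have "l $ i \<le> u $ i" for i
      using le[OF axis_in_Basis] by (simp add: inner_axis)
    then have "T' l \<bullet> b \<le> T' u \<bullet> b" if "b \<in> Basis" for b
      using that by (auto simp: Basis_vec_def T'_def inner_axis)
    ultimately have "emeasure (distr lborel borel T) (box l u) = ennreal (\<Prod>i\<in>UNIV. (u - l) $ inv p i)"
      by (simp add: emeasure_distr prod_Basis_cart inner_axis T'_def)
    also have "(\<Prod>i\<in>UNIV. (u - l) $ inv p i) = (\<Prod>i\<in>UNIV. (u - l) $ i)"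
      using prod.permute[OF permutes_inv[OF p], of "\<lambda>i. (u - l) $ i"] by (simp add: o_def)
    finally show "emeasure (distr lborel borel T) (box l u) = (\<Prod>b\<in>Basis. (u - l) \<bullet> b)"
      by (simp add: prod_Basis_cart inner_axis)
  qed simp
  then have "(\<integral>\<^sup>+x. f x \<partial>lborel) = (\<integral>\<^sup>+x. f x \<partial>distr lborel borel T)" by simp
  then show ?thesis by (simp add: nn_integral_distr T_def)
qed

lemma nn_integral_lborel_diagonal:
  fixes A :: "real^'n^'n" and f :: "real^'n \<Rightarrow> ennreal"
  assumes diag: "\<And>i j. i \<noteq> j \<Longrightarrow> A $ i $ j = 0" and nz: "det A \<noteq> 0"
    and [measurable]: "f \<in> borel_measurable borel"
  shows "ennreal \<bar>det A\<bar> * (\<integral>\<^sup>+x. f (A *v x) \<partial>lborel) = (\<integral>\<^sup>+x. f x \<partial>lborel)"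
proof -
  define c where "c b = b \<bullet> (A *v b)" for b :: "real^'n"
  have entry: "c (axis i 1) = A $ i $ i" for i
    unfolding c_def by (rule matrix_entry[symmetric])
  have det: "det A = (\<Prod>i\<in>UNIV. A $ i $ i)"
    by (rule det_diagonal) (rule diag)
  have c: "c b \<noteq> 0" if "b \<in> Basis" for b
    using that nz det entry by (auto simp: Basis_vec_def)
  \<comment> \<open>Written with a translation part \<open>0\<close>, the shape of the affine maps in \<open>lborel_affine_euclidean\<close>.\<close>
  have T: "0 + (\<Sum>b\<in>Basis. (c b * (x \<bullet> b)) *\<^sub>R b) = A *v x" for x
  proof (rule euclidean_eqI)
    fix b :: "real^'n" assume b: "b \<in> Basis"
    then obtain i where i: "b = axis i 1" by (auto simp: Basis_vec_def)
    have "(0 + (\<Sum>b\<in>Basis. (c b * (x \<bullet> b)) *\<^sub>R b)) \<bullet> b = c b * (x \<bullet> b)"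
      using b by (simp add: inner_sum_left inner_Basis if_distrib cong: if_cong)
    also have "\<dots> = A $ i $ i * x $ i"
      by (simp add: i entry inner_axis)
    also have "\<dots> = (A *v x) \<bullet> b"
      using diag by (simp add: i inner_axis matrix_vector_mult_def sum.remove[of UNIV i])
    finally show "(0 + (\<Sum>b\<in>Basis. (c b * (x \<bullet> b)) *\<^sub>R b)) \<bullet> b = (A *v x) \<bullet> b" .
  qed
  have "(\<Prod>b\<in>Basis. \<bar>c b\<bar>) = \<bar>det A\<bar>"
    by (simp add: prod_Basis_cart entry det abs_prod)
  then have "lborel = density (distr lborel borel ((*v) A)) (\<lambda>_. ennreal \<bar>det A\<bar>)"
    using lborel_affine_euclidean[of c 0, OF c] unfolding T by simp
  then have "(\<integral>\<^sup>+x. f x \<partial>lborel) = (\<integral>\<^sup>+x. f x \<partial>density (distr lborel borel ((*v) A)) (\<lambda>_. ennreal \<bar>det A\<bar>))"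
    by simp
  then show ?thesis
    by (simp add: nn_integral_density nn_integral_distr nn_integral_cmult)
qed

text \<open>
Every square matrix is a product of factors that are diagonal, swap two coordinates, add
a multiple of one coordinate to another, or have a zero row. The formula is
multiplicative, so it suffices to check these factors; those with a zero row are
singular and do not occur. Composition applies the formula to changed integrands, whence
the quantifier over \<open>f\<close> inside \<open>P\<close>.
\<close>

lemma nn_integral_lborel_matrix:
  fixes L :: "real^'n^'n" and f :: "real^'n \<Rightarrow> ennreal"
  assumes "det L \<noteq> 0" "f \<in> borel_measurable borel"
  shows "ennreal \<bar>det L\<bar> * (\<integral>\<^sup>+x. f (L *v x) \<partial>lborel) = (\<integral>\<^sup>+x. f x \<partial>lborel)"
proof -
  \<comment> \<open>The factorisation exists for singular matrices too, so invertibility goes into the predicate.\<close>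
  define P where "P L \<longleftrightarrow> (det L \<noteq> 0 \<longrightarrow> (\<forall>f::real^'n \<Rightarrow> ennreal. f \<in> borel_measurable borel \<longrightarrow>
    ennreal \<bar>det L\<bar> * (\<integral>\<^sup>+x. f (L *v x) \<partial>lborel) = (\<integral>\<^sup>+x. f x \<partial>lborel)))" for L :: "real^'n^'n"
  have "P L"
  proof (rule induct_matrix_elementary)
    fix A B :: "real^'n^'n"
    assume A: "P A" and B: "P B"
    show "P (A ** B)"
      unfolding P_def
    proof (intro impI allI)
      fix f :: "real^'n \<Rightarrow> ennreal"
      assume nz: "det (A ** B) \<noteq> 0" and [measurable]: "f \<in> borel_measurable borel"
      have "ennreal \<bar>det (A ** B)\<bar> * (\<integral>\<^sup>+x. f ((A ** B) *v x) \<partial>lborel)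
          = ennreal \<bar>det A\<bar> * (ennreal \<bar>det B\<bar> * (\<integral>\<^sup>+x. f (A *v (B *v x)) \<partial>lborel))"
        by (simp add: det_mul abs_mult ennreal_mult matrix_vector_mul_assoc mult.assoc)
      also have "ennreal \<bar>det B\<bar> * (\<integral>\<^sup>+x. f (A *v (B *v x)) \<partial>lborel) = (\<integral>\<^sup>+x. f (A *v x) \<partial>lborel)"
        using nz by (intro B[unfolded P_def, rule_format]) (auto simp: det_mul)
      also have "ennreal \<bar>det A\<bar> * (\<integral>\<^sup>+x. f (A *v x) \<partial>lborel) = (\<integral>\<^sup>+x. f x \<partial>lborel)"
        using nz by (intro A[unfolded P_def, rule_format]) (auto simp: det_mul)
      finally show "ennreal \<bar>det (A ** B)\<bar> * (\<integral>\<^sup>+x. f ((A ** B) *v x) \<partial>lborel) = (\<integral>\<^sup>+x. f x \<partial>lborel)" .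
    qed
  next
    fix A :: "real^'n^'n" and i
    assume "row i A = 0"
    then show "P A" unfolding P_def by (simp add: det_zero_row)
  next
    fix A :: "real^'n^'n"
    assume "\<And>i j. i \<noteq> j \<Longrightarrow> A $ i $ j = 0"
    then show "P A" unfolding P_def by (simp add: nn_integral_lborel_diagonal)
  next
    fix m n :: 'n
    assume "m \<noteq> n"
    define p where "p = Transposition.transpose m n"
    have p: "p permutes UNIV" unfolding p_def by (rule permutes_swap_id) auto
    define A :: "real^'n^'n" where "A = (\<chi> i j. mat 1 $ i $ p j)"
    have "det A = of_int (sign p) * det (mat 1 :: real^'n^'n)"
      unfolding A_def by (rule det_permute_columns[OF p])
    then have "\<bar>det A\<bar> = 1" by (simp add: sign_def)
    moreover have "A *v x = (\<chi> i. x $ p i)" for x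
    proof -
      have "(\<Sum>j\<in>UNIV. A $ i $ j * x $ j) = (\<Sum>j\<in>UNIV. if j = p i then x $ j else 0)" for i
        by (intro sum.cong) (auto simp: A_def mat_def p_def transpose_eq_iff)
      then show ?thesis by (simp add: matrix_vector_mult_def vec_eq_iff)
    qed
    ultimately show "P (\<chi> i j. mat 1 $ i $ Transposition.transpose m n j)"
      unfolding P_def p_def[symmetric] A_def[symmetric]
      by (simp add: nn_integral_lborel_permute[OF p])
  next
    fix m n :: 'n and c :: real
    assume mn: "m \<noteq> n"
    define A :: "real^'n^'n" where "A = (\<chi> i j. if i = m \<and> j = n then c else of_bool (i = j))"
    have "A = (\<chi> k. if k = m then row m (mat 1) + c *s row n (mat 1) else row k (mat 1))"
      using mn by (auto simp: A_def vec_eq_iff row_def mat_def)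
    then have "det A = 1"
      using det_row_operation[OF mn, of "mat 1" c] by simp
    moreover have "A *v x = x + (c * x $ n) *\<^sub>R axis m 1" for x
    proof -
      have "(\<Sum>j\<in>UNIV. A $ i $ j * x $ j)
          = (\<Sum>j\<in>UNIV. (if j = i then x $ j else 0) + (if j = n then (if i = m then c * x $ j else 0) else 0))" for i
        using mn by (intro sum.cong) (auto simp: A_def)
      then show ?thesis by (simp add: matrix_vector_mult_def vec_eq_iff sum.distrib axis_def)
    qed
    moreover have "(\<integral>\<^sup>+x. f (x + (c * x $ n) *\<^sub>R axis m 1) \<partial>lborel) = (\<integral>\<^sup>+x. f x \<partial>lborel)"
      if "f \<in> borel_measurable borel" for f :: "real^'n \<Rightarrow> ennreal"
    proof -
      have "axis m (1::real) $ n = 0" using mn by (simp add: axis_def)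
      then show ?thesis
        using that
        by (intro nn_integral_lborel_shear axis_in_Basis)
          (auto intro!: borel_measurable_continuous_onI continuous_intros)
    qed
    ultimately show "P (\<chi> i j. if i = m \<and> j = n then c else of_bool (i = j))"
      unfolding P_def A_def[symmetric] by simp
  qed
  with assms show ?thesis unfolding P_def by blast
qed

section \<open>Gaussian integrals\<close>

lemma nn_integral_standard_gaussian:
  "(\<integral>\<^sup>+x. ennreal (exp (- (x \<bullet> x / 2))) \<partial>(lborel :: (real^'n) measure)) = ennreal (sqrt ((2 * pi) ^ CARD('n)))"
proof -
  have "(\<integral>\<^sup>+t. ennreal (exp (- (t\<^sup>2 / 2))) \<partial>lborel)
      = (\<integral>\<^sup>+t. ennreal (sqrt (2 * pi)) * ennreal (std_normal_density t) \<partial>lborel)"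
    by (simp add: std_normal_density_def ennreal_mult'[symmetric])
  also have "\<dots> = ennreal (sqrt (2 * pi))"
    by (simp add: nn_integral_cmult nn_integral_eq_integral)
  finally have one: "(\<integral>\<^sup>+t. ennreal (exp (- (t\<^sup>2 / 2))) \<partial>lborel) = ennreal (sqrt (2 * pi))" .
  have "exp (- (x \<bullet> x / 2)) = (\<Prod>b\<in>Basis. exp (- ((x \<bullet> b)\<^sup>2 / 2)))" for x :: "real^'n"
    by (simp add: euclidean_inner[of x x] exp_sum[symmetric] sum_negf[symmetric]
        sum_divide_distrib power2_eq_square)
  then have "(\<integral>\<^sup>+x. ennreal (exp (- (x \<bullet> x / 2))) \<partial>(lborel :: (real^'n) measure))
      = (\<integral>\<^sup>+x. (\<Prod>b\<in>Basis. ennreal (exp (- ((x \<bullet> b)\<^sup>2 / 2)))) \<partial>(lborel :: (real^'n) measure))"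
    by (simp add: prod_ennreal)
  also have "\<dots> = (\<Prod>b\<in>(Basis :: (real^'n) set). \<integral>\<^sup>+t. ennreal (exp (- (t\<^sup>2 / 2))) \<partial>lborel)"
    by (rule nn_integral_lborel_prod) auto
  also have "\<dots> = ennreal (sqrt ((2 * pi) ^ CARD('n)))"
    by (simp add: one ennreal_power real_sqrt_power[symmetric] power_mult_distrib)
  finally show ?thesis .
qed

lemma
  fixes S :: "real^'n^'n"
  assumes "pos_def S"
  shows det_pos_def: "0 < det S"
    and nn_integral_gaussian: "(\<integral>\<^sup>+x. ennreal (exp (- ((x - a) \<bullet> (S *v (x - a)) / 2))) \<partial>lborel)
      = ennreal (sqrt ((2 * pi) ^ CARD('n) / det S))"
proof -
  obtain L :: "real^'n^'n" where L: "transpose L ** S ** L = mat 1"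
    using pos_def_congruent_to_identity[OF assms] by blast
  have "det (transpose L ** S ** L) = 1" by (simp add: L)
  then have dd: "(det L)\<^sup>2 * det S = 1"
    by (simp add: det_mul det_transpose power2_eq_square mult.commute mult.left_commute)
  then have nz: "det L \<noteq> 0" by auto
  show pos: "0 < det S"
    using dd nz by (smt (verit) zero_less_mult_pos zero_less_power2)
  have quad: "(L *v x) \<bullet> (S *v (L *v x)) = x \<bullet> x" for x
  proof -
    have "x \<bullet> ((transpose L ** S ** L) *v x) = (L *v x) \<bullet> (S *v (L *v x))"
      using inner_transpose[of x "transpose L" "S *v (L *v x)"]
      by (simp add: matrix_vector_mul_assoc[symmetric])
    then show ?thesis by (simp add: L)
  qed
  have "\<bar>det L\<bar> = sqrt ((det L)\<^sup>2)" by simp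
  also have "(det L)\<^sup>2 = 1 / det S" using dd pos by (simp add: field_simps)
  finally have dL: "\<bar>det L\<bar> = sqrt (1 / det S)" .
  have "(\<integral>\<^sup>+x. ennreal (exp (- ((x - a) \<bullet> (S *v (x - a)) / 2))) \<partial>lborel)
      = (\<integral>\<^sup>+x. ennreal (exp (- ((x - a) \<bullet> (S *v (x - a)) / 2))) \<partial>distr lborel borel ((+) a))"
    by (simp add: lborel_distr_plus)
  also have "\<dots> = (\<integral>\<^sup>+x. ennreal (exp (- (x \<bullet> (S *v x) / 2))) \<partial>lborel)"
    by (subst nn_integral_distr) simp_all
  also have "\<dots> = ennreal \<bar>det L\<bar> * (\<integral>\<^sup>+x. ennreal (exp (- (x \<bullet> x / 2))) \<partial>(lborel :: (real^'n) measure))"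
    using nn_integral_lborel_matrix[OF nz, of "\<lambda>x. ennreal (exp (- (x \<bullet> (S *v x) / 2)))"]
    by (simp add: quad)
  also have "\<dots> = ennreal (sqrt ((2 * pi) ^ CARD('n) / det S))"
    using pos by (simp add: nn_integral_standard_gaussian dL ennreal_mult'[symmetric] real_sqrt_mult[symmetric])
  finally show "(\<integral>\<^sup>+x. ennreal (exp (- ((x - a) \<bullet> (S *v (x - a)) / 2))) \<partial>lborel)
      = ennreal (sqrt ((2 * pi) ^ CARD('n) / det S))" .
qed

text \<open>
The moment generating function of a quadratic form in a shifted Gaussian vector: after
the square is completed, the remaining integral is a Gaussian one with precision \<open>S\<close>,
and the normalising constants of \<open>C\<close> and \<open>S\<close> combine to \<open>det (S ** C)\<close>. Positive
definiteness of \<open>S\<close> makes the integral finite.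
\<close>

lemma gaussian_exponential_quadratic:
  fixes C G :: "real^'n^'n"
  assumes C: "pos_def C" and G: "pos_semidef G"
    and S: "S = matrix_inv C - (2 * \<theta>) *\<^sub>R G" "pos_def S"
  shows "(\<integral>\<^sup>+x. ennreal (gaussian_density 0 C x) * ennreal (exp (\<theta> * ((y + x) \<bullet> (G *v (y + x))))) \<partial>lborel)
    = ennreal (exp (\<theta> * (y \<bullet> (risk_adjusted \<theta> S G *v y))) / sqrt (det (S ** C)))"
proof -
  define a where "a = (2 * \<theta>) *\<^sub>R (matrix_inv S *v (G *v y))"
  define q where "q = \<theta> * (y \<bullet> (risk_adjusted \<theta> S G *v y))"
  define k where "k = sqrt ((2 * pi) ^ CARD('n) * det C)"
  have sym: "transpose G = G" "transpose S = S" "invertible S"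
    using G S(2) invertible_pos_def by (auto simp: pos_def_def pos_semidef_def)
  have pos: "0 < det C" "0 < det S"
    using C S(2) by (auto intro: det_pos_def)
  have integrand: "ennreal (gaussian_density 0 C x) * ennreal (exp (\<theta> * ((y + x) \<bullet> (G *v (y + x)))))
      = ennreal (exp q / k) * ennreal (exp (- ((x - a) \<bullet> (S *v (x - a)) / 2)))" for x
  proof -
    have "gaussian_density 0 C x * exp (\<theta> * ((y + x) \<bullet> (G *v (y + x))))
       = exp (\<theta> * ((y + x) \<bullet> (G *v (y + x))) - x \<bullet> (matrix_inv C *v x) / 2) / k"
      by (simp add: gaussian_density_def k_def mult_exp_exp add.commute)
    also have "\<dots> = exp (q - (x - a) \<bullet> (S *v (x - a)) / 2) / k"
      using complete_square_noise[OF sym(1) S(1) sym(2,3), of y x]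
      by (simp add: q_def a_def)
    also have "\<dots> = exp q / k * exp (- ((x - a) \<bullet> (S *v (x - a)) / 2))"
      by (simp add: mult_exp_exp)
    finally show ?thesis
      by (simp only: ennreal_mult''[symmetric] exp_ge_zero)
  qed
  have "(\<integral>\<^sup>+x. ennreal (gaussian_density 0 C x) * ennreal (exp (\<theta> * ((y + x) \<bullet> (G *v (y + x))))) \<partial>lborel)
      = ennreal (exp q / k) * ennreal (sqrt ((2 * pi) ^ CARD('n) / det S))"
    unfolding integrand by (simp add: nn_integral_cmult nn_integral_gaussian[OF S(2)])
  also have "\<dots> = ennreal (exp q / k * sqrt ((2 * pi) ^ CARD('n) / det S))"
    using pos by (intro ennreal_mult[symmetric]) (auto simp: k_def)
  also have "exp q / k * sqrt ((2 * pi) ^ CARD('n) / det S) = exp q / sqrt (det (S ** C))"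
    using pos by (simp add: k_def det_mul real_sqrt_mult real_sqrt_divide field_simps)
  finally show ?thesis by (simp add: q_def)
qed

section \<open>One controlled step\<close>

text \<open>
The Bellman equation for an arbitrary nominal input \<open>v\<close>, not just the optimal one: the
expectation of the exponentiated one-step cost plus next value is the exponentiated
current value, times a factor that measures the deviation of \<open>v\<close> from the feedback \<open>K
x\<close>. The process noise is integrated first, because the input noise enters it through the
mean of the next state.
\<close>

lemma gaussian_control_step:
  fixes A Q P' P W S :: "real^'n^'n" and B :: "real^'m^'n" and R H \<Sigma> \<Xi> :: "real^'m^'m"
    and K :: "real^'n^'m"
  assumes \<theta>: "\<theta> \<noteq> 0" and pd: "pos_def W" "pos_def \<Sigma>" "pos_def R" "pos_semidef P'" "pos_semidef Q"
    and S: "S = matrix_inv W - (2 * \<theta>) *\<^sub>R P'" "pos_def S"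
    and H: "H = R + transpose B ** risk_adjusted \<theta> S P' ** B"
    and \<Xi>: "\<Xi> = matrix_inv \<Sigma> - (2 * \<theta>) *\<^sub>R H" "pos_def \<Xi>"
    and K: "K = - (matrix_inv H ** transpose B ** risk_adjusted \<theta> S P' ** A)"
    and P: "P = Q + transpose A ** risk_adjusted \<theta> S P' ** A
                - transpose A ** risk_adjusted \<theta> S P' ** B ** matrix_inv H
                  ** transpose B ** risk_adjusted \<theta> S P' ** A"
    and \<eta>: "\<eta> = \<eta>' - 1 / (2 * \<theta>) * ln (det (S ** W) * det (\<Xi> ** \<Sigma>))"
  shows "(\<integral>\<^sup>+e. ennreal (gaussian_density 0 \<Sigma> e) * (\<integral>\<^sup>+w. ennreal (gaussian_density 0 W w) *
      ennreal (exp (\<theta> * (x \<bullet> (Q *v x) + (v + e) \<bullet> (R *v (v + e)) +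
        (A *v x + B *v (v + e) + w) \<bullet> (P' *v (A *v x + B *v (v + e) + w)) + \<eta>'))) \<partial>lborel) \<partial>lborel)
    = ennreal (exp (\<theta> * (x \<bullet> (P *v x) + \<eta>)) *
        exp (\<theta> * ((v - K *v x) \<bullet> (risk_adjusted \<theta> \<Xi> H *v (v - K *v x)))))"
proof -
  define G where "G = risk_adjusted \<theta> S P'"
  define z where "z = v - K *v x"
  define dw where "dw = sqrt (det (S ** W))"
  define de where "de = sqrt (det (\<Xi> ** \<Sigma>))"
  have G: "pos_semidef G"
    unfolding G_def using pos_def_matrix_inv[OF pd(1)] pd(4) S \<theta> by (rule pos_semidef_risk_adjusted)
  have Hpd: "pos_def H"
    using pos_semidef_riccati_step[OF G pd(5,3)] H P unfolding G_def by blast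
  have sym: "transpose G = G" "transpose H = H" "invertible H"
    using G Hpd invertible_pos_def by (auto simp: pos_def_def pos_semidef_def)
  have dets: "0 < det (S ** W)" "0 < det (\<Xi> ** \<Sigma>)"
    using det_pos_def[OF S(2)] det_pos_def[OF \<Xi>(2)] det_pos_def[OF pd(1)] det_pos_def[OF pd(2)]
    by (simp_all add: det_mul)
  have inner: "(\<integral>\<^sup>+w. ennreal (gaussian_density 0 W w) *
      ennreal (exp (\<theta> * (x \<bullet> (Q *v x) + (v + e) \<bullet> (R *v (v + e)) +
        (A *v x + B *v (v + e) + w) \<bullet> (P' *v (A *v x + B *v (v + e) + w)) + \<eta>'))) \<partial>lborel)
    = ennreal (exp (\<theta> * (x \<bullet> (P *v x) + \<eta>')) / dw) * ennreal (exp (\<theta> * ((z + e) \<bullet> (H *v (z + e)))))"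
    for e
  proof -
    define y where "y = A *v x + B *v (v + e)"
    define c where "c = x \<bullet> (Q *v x) + (v + e) \<bullet> (R *v (v + e))"
    have "(\<integral>\<^sup>+w. ennreal (gaussian_density 0 W w) *
        ennreal (exp (\<theta> * (c + (y + w) \<bullet> (P' *v (y + w)) + \<eta>'))) \<partial>lborel)
      = (\<integral>\<^sup>+w. ennreal (exp (\<theta> * (c + \<eta>'))) * (ennreal (gaussian_density 0 W w) *
        ennreal (exp (\<theta> * ((y + w) \<bullet> (P' *v (y + w)))))) \<partial>lborel)"
    proof (intro nn_integral_cong)
      fix w
      have "exp (\<theta> * (c + (y + w) \<bullet> (P' *v (y + w)) + \<eta>'))
          = exp (\<theta> * (c + \<eta>')) * exp (\<theta> * ((y + w) \<bullet> (P' *v (y + w))))"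
        by (simp only: mult_exp_exp distrib_left add.assoc add.commute add.left_commute)
      then show "ennreal (gaussian_density 0 W w) * ennreal (exp (\<theta> * (c + (y + w) \<bullet> (P' *v (y + w)) + \<eta>')))
        = ennreal (exp (\<theta> * (c + \<eta>'))) * (ennreal (gaussian_density 0 W w) *
          ennreal (exp (\<theta> * ((y + w) \<bullet> (P' *v (y + w))))))"
        by (simp only: ennreal_mult'' exp_ge_zero mult.left_commute)
    qed
    also have "\<dots> = ennreal (exp (\<theta> * (c + \<eta>'))) * ennreal (exp (\<theta> * (y \<bullet> (G *v y))) / dw)"
      unfolding G_def dw_def gaussian_exponential_quadratic[OF pd(1,4) S, symmetric]
      by (rule nn_integral_cmult) (simp add: gaussian_density_def)
    also have "\<dots> = ennreal (exp (\<theta> * (c + y \<bullet> (G *v y)) + \<theta> * \<eta>') / dw)"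
      using dets
      by (simp add: ennreal_mult'[symmetric] dw_def mult_exp_exp distrib_left algebra_simps)
    also have "c + y \<bullet> (G *v y) = x \<bullet> (P *v x) + (z + e) \<bullet> (H *v (z + e))"
      using complete_square_control[OF sym(1) H[folded G_def] sym(2,3) K[folded G_def]
          P[folded G_def], of x "v + e"]
      by (simp add: c_def y_def z_def algebra_simps)
    also have "exp (\<theta> * (x \<bullet> (P *v x) + (z + e) \<bullet> (H *v (z + e))) + \<theta> * \<eta>') / dw
      = exp (\<theta> * (x \<bullet> (P *v x) + \<eta>')) / dw * exp (\<theta> * ((z + e) \<bullet> (H *v (z + e))))"
      by (simp add: mult_exp_exp distrib_left add.assoc add.commute add.left_commute)
    finally show ?thesis
      by (simp only: c_def y_def ennreal_mult'' exp_ge_zero)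
  qed
  \<comment> \<open>The recursion for \<open>\<eta>\<close> is made so that it absorbs the two normalising factors.\<close>
  have const: "exp (\<theta> * (x \<bullet> (P *v x) + \<eta>')) / dw / de = exp (\<theta> * (x \<bullet> (P *v x) + \<eta>))"
  proof -
    have "dw * de = sqrt (det (S ** W) * det (\<Xi> ** \<Sigma>))"
      unfolding dw_def de_def by (simp add: real_sqrt_mult)
    also have "\<dots> = exp (ln (det (S ** W) * det (\<Xi> ** \<Sigma>)) / 2)"
      using dets by (simp add: ln_sqrt[symmetric])
    also have "ln (det (S ** W) * det (\<Xi> ** \<Sigma>)) / 2 = \<theta> * \<eta>' - \<theta> * \<eta>"
      using \<theta> by (simp add: \<eta> field_simps)
    finally have "exp (\<theta> * \<eta>) * (dw * de) = exp (\<theta> * \<eta>')"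
      by (simp add: mult_exp_exp)
    moreover have "0 < dw" "0 < de" using dets by (simp_all add: dw_def de_def)
    ultimately show ?thesis
      by (simp add: distrib_left exp_add field_simps)
  qed
  have "(\<integral>\<^sup>+e. ennreal (gaussian_density 0 \<Sigma> e) * (ennreal (exp (\<theta> * (x \<bullet> (P *v x) + \<eta>')) / dw) *
        ennreal (exp (\<theta> * ((z + e) \<bullet> (H *v (z + e)))))) \<partial>lborel)
    = ennreal (exp (\<theta> * (x \<bullet> (P *v x) + \<eta>')) / dw) *
        ennreal (exp (\<theta> * (z \<bullet> (risk_adjusted \<theta> \<Xi> H *v z))) / de)"
    unfolding de_def gaussian_exponential_quadratic[OF pd(2) pos_semidef_if_pos_def[OF Hpd] \<Xi>, symmetric]
    by (subst nn_integral_cmult[symmetric]) (simp_all add: gaussian_density_def mult.left_commute)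
  also have "\<dots> = ennreal (exp (\<theta> * (x \<bullet> (P *v x) + \<eta>)) *
        exp (\<theta> * (z \<bullet> (risk_adjusted \<theta> \<Xi> H *v z))))"
    using dets unfolding const[symmetric]
    by (subst ennreal_mult''[symmetric]) (simp_all add: de_def dw_def)
  finally show ?thesis
    unfolding inner z_def .
qed

section \<open>Independence of past and present noise\<close>

lemma preimage_in_sigma_sets:
  assumes "G \<subseteq> Pow \<Omega>" "Z \<in> measurable (sigma \<Omega> G) U" "D \<in> sets U"
  shows "Z -` D \<inter> \<Omega> \<in> sigma_sets \<Omega> G"
  using measurable_sets[OF assms(2,3)] assms(1) by simp

lemma measurable_from_sub_sigma:
  assumes "G \<subseteq> sets M" "Z \<in> measurable (sigma (space M) G) U"
  shows "Z \<in> measurable M U"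
proof (rule measurableI)
  have G: "G \<subseteq> Pow (space M)" using assms(1) sets.space_closed[of M] by blast
  show "Z \<omega> \<in> space U" if "\<omega> \<in> space M" for \<omega>
    using measurable_space[OF assms(2), of \<omega>] that G by simp
  show "Z -` D \<inter> space M \<in> sets M" if "D \<in> sets U" for D
    using preimage_in_sigma_sets[OF G assms(2) that] sets.sigma_sets_subset[OF assms(1)] by blast
qed

text \<open>
Random variables that depend on disjoint groups of an independent family have a product
joint law. The two variables may have different value types, as the data of the past and
the pair of fresh noises do below; independence is therefore expressed by the
factorisation of the joint law.
\<close>

lemma (in prob_space) product_law_sub_algebras:
  assumes indep: "indep_sets E I" and stable: "\<And>i. i \<in> I \<Longrightarrow> Int_stable (E i)"
    and J: "J1 \<subseteq> I" "J2 \<subseteq> I" "J1 \<inter> J2 = {}"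
    and X: "X \<in> measurable (sigma (space M) (\<Union>i\<in>J1. E i)) S"
    and Y: "Y \<in> measurable (sigma (space M) (\<Union>i\<in>J2. E i)) T"
  shows "random_variable S X" "random_variable T Y"
    and "distr M S X \<Otimes>\<^sub>M distr M T Y = distr M (S \<Otimes>\<^sub>M T) (\<lambda>\<omega>. (X \<omega>, Y \<omega>))"
proof -
  have events: "(\<Union>i\<in>J. E i) \<subseteq> events" if "J \<subseteq> I" for J
    using indep that unfolding indep_sets_def by blast
  have Pow: "(\<Union>i\<in>J. E i) \<subseteq> Pow (space M)" if "J \<subseteq> I" for J
    using events[OF that] sets.space_closed[of M] by blast
  have "indep_sets (\<lambda>b. sigma_sets (space M) (\<Union>i\<in>case_bool J1 J2 b. E i)) UNIV"
  proof (rule indep_sets_collect_sigma)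
    show "indep_sets E (\<Union>b. case_bool J1 J2 b)"
      by (rule indep_sets_mono_index[OF _ indep]) (use J in \<open>auto split: bool.splits\<close>)
    show "Int_stable (E i)" if "i \<in> case_bool J1 J2 b" for i b
      using that J by (intro stable) (auto split: bool.splits)
    show "disjoint_family_on (case_bool J1 J2) UNIV"
      using J(3) by (auto simp: disjoint_family_on_def split: bool.splits)
  qed
  then have indep2: "indep_set (sigma_sets (space M) (\<Union>i\<in>J1. E i)) (sigma_sets (space M) (\<Union>i\<in>J2. E i))"
    unfolding indep_set_def by (rule indep_sets_mono_sets) (auto split: bool.splits)
  show rvs[measurable]: "random_variable S X" "random_variable T Y"
    using measurable_from_sub_sigma[OF events[OF J(1)] X]
      measurable_from_sub_sigma[OF events[OF J(2)] Y] .
  interpret X: prob_space "distr M S X" by (rule prob_space_distr) simp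
  interpret Y: prob_space "distr M T Y" by (rule prob_space_distr) simp
  show "distr M S X \<Otimes>\<^sub>M distr M T Y = distr M (S \<Otimes>\<^sub>M T) (\<lambda>\<omega>. (X \<omega>, Y \<omega>))"
  proof (rule pair_measure_eqI)
    fix C D
    assume "C \<in> sets (distr M S X)" "D \<in> sets (distr M T Y)"
    then have C: "C \<in> sets S" and D: "D \<in> sets T" by simp_all
    have "prob ((X -` C \<inter> space M) \<inter> (Y -` D \<inter> space M)) = prob (X -` C \<inter> space M) * prob (Y -` D \<inter> space M)"
      by (intro indep_setD[OF indep2] preimage_in_sigma_sets[OF Pow[OF J(1)] X C]
          preimage_in_sigma_sets[OF Pow[OF J(2)] Y D])
    moreover have "(\<lambda>\<omega>. (X \<omega>, Y \<omega>)) -` (C \<times> D) \<inter> space M = (X -` C \<inter> space M) \<inter> (Y -` D \<inter> space M)"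
      by auto
    ultimately show "emeasure (distr M S X) C * emeasure (distr M T Y) D =
        emeasure (distr M (S \<Otimes>\<^sub>M T) (\<lambda>\<omega>. (X \<omega>, Y \<omega>))) (C \<times> D)"
      using C D by (simp add: emeasure_distr emeasure_eq_measure ennreal_mult'')
  qed (simp_all add: X.sigma_finite_measure_axioms Y.sigma_finite_measure_axioms
      cong: sets_pair_measure_cong)
qed

text \<open>
Freezing: to average over \<open>Y\<close> given the independent \<open>X\<close>, treat \<open>X\<close> as a constant.
\<close>

lemma (in prob_space) nn_integral_product_law:
  assumes rv[measurable]: "random_variable S X" "random_variable T Y"
    and joint: "distr M S X \<Otimes>\<^sub>M distr M T Y = distr M (S \<Otimes>\<^sub>M T) (\<lambda>\<omega>. (X \<omega>, Y \<omega>))"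
    and f: "f \<in> borel_measurable (S \<Otimes>\<^sub>M T)"
  shows "(\<integral>\<^sup>+\<omega>. f (X \<omega>, Y \<omega>) \<partial>M) = (\<integral>\<^sup>+\<omega>. (\<integral>\<^sup>+y. f (X \<omega>, y) \<partial>distr M T Y) \<partial>M)"
proof -
  note f[measurable]
  interpret Y: prob_space "distr M T Y" by (rule prob_space_distr) simp
  have fD: "f \<in> borel_measurable (distr M S X \<Otimes>\<^sub>M distr M T Y)"
    using f by (simp cong: measurable_cong_sets sets_pair_measure_cong)
  have "(\<integral>\<^sup>+\<omega>. f (X \<omega>, Y \<omega>) \<partial>M) = (\<integral>\<^sup>+p. f p \<partial>distr M (S \<Otimes>\<^sub>M T) (\<lambda>\<omega>. (X \<omega>, Y \<omega>)))"
    by (simp add: nn_integral_distr)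
  also have "\<dots> = (\<integral>\<^sup>+p. f p \<partial>(distr M S X \<Otimes>\<^sub>M distr M T Y))"
    by (simp add: joint)
  also have "\<dots> = (\<integral>\<^sup>+x. (\<integral>\<^sup>+y. f (x, y) \<partial>distr M T Y) \<partial>distr M S X)"
    by (rule Y.nn_integral_fst[symmetric]) (rule fD)
  also have "\<dots> = (\<integral>\<^sup>+\<omega>. (\<integral>\<^sup>+y. f (X \<omega>, y) \<partial>distr M T Y) \<partial>M)"
  proof -
    have "(\<lambda>x. \<integral>\<^sup>+y. f (x, y) \<partial>distr M T Y) \<in> borel_measurable (distr M S X)"
      by (rule Y.borel_measurable_nn_integral_fst[OF fD])
    then have "(\<lambda>x. \<integral>\<^sup>+y. f (x, y) \<partial>distr M T Y) \<in> borel_measurable S" by simp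
    then show ?thesis by (subst nn_integral_distr) simp_all
  qed
  finally show ?thesis .
qed

definition noise_events ::
  "'a measure \<Rightarrow> (nat \<Rightarrow> 'a \<Rightarrow> real^'n) \<Rightarrow> (nat \<Rightarrow> 'a \<Rightarrow> real^'m) \<Rightarrow> nat + nat \<Rightarrow> 'a set set" where
  "noise_events M w e = case_sum (\<lambda>t. {w t -` D \<inter> space M |D. D \<in> sets borel})
    (\<lambda>t. {e t -` D \<inter> space M |D. D \<in> sets borel})"

definition noise_algebra ::
  "'a measure \<Rightarrow> (nat \<Rightarrow> 'a \<Rightarrow> real^'n) \<Rightarrow> (nat \<Rightarrow> 'a \<Rightarrow> real^'m) \<Rightarrow> (nat + nat) set \<Rightarrow> 'a measure" where
  "noise_algebra M w e J = sigma (space M) (\<Union>i\<in>J. noise_events M w e i)"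

lemma Int_stable_preimages: "Int_stable {X -` D \<inter> \<Omega> |D. D \<in> sets borel}"
proof (rule Int_stableI)
  fix a b
  assume "a \<in> {X -` D \<inter> \<Omega> |D. D \<in> sets borel}" "b \<in> {X -` D \<inter> \<Omega> |D. D \<in> sets borel}"
  then obtain D D' where D: "D \<in> sets borel" "D' \<in> sets borel"
    and ab: "a = X -` D \<inter> \<Omega>" "b = X -` D' \<inter> \<Omega>"
    by blast
  have "a \<inter> b = X -` (D \<inter> D') \<inter> \<Omega>" unfolding ab by blast
  with D show "a \<inter> b \<in> {X -` D \<inter> \<Omega> |D. D \<in> sets borel}"
    using sets.Int[OF D] by blast
qed

lemma Int_stable_noise_events: "Int_stable (noise_events M w e i)"
  by (simp add: noise_events_def Int_stable_preimages split: sum.split)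

lemma measurable_sigma_preimages:
  fixes X :: "'a \<Rightarrow> 'b::topological_space"
  assumes "G \<subseteq> Pow \<Omega>" "{X -` D \<inter> \<Omega> |D. D \<in> sets borel} \<subseteq> G"
  shows "X \<in> borel_measurable (sigma \<Omega> G)"
proof (rule measurableI)
  fix D :: "'b set" assume "D \<in> sets borel"
  then have "X -` D \<inter> \<Omega> \<in> G" using assms(2) by blast
  then show "X -` D \<inter> space (sigma \<Omega> G) \<in> sets (sigma \<Omega> G)" using assms(1) by simp
qed simp

lemma measurable_noise_algebra:
  shows "Inl t \<in> J \<Longrightarrow> w t \<in> borel_measurable (noise_algebra M w e J)"
    and "Inr t \<in> J \<Longrightarrow> e t \<in> borel_measurable (noise_algebra M w e J)"
proof -
  have Pow: "(\<Union>i\<in>J. noise_events M w e i) \<subseteq> Pow (space M)"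
    by (auto simp: noise_events_def split: sum.splits)
  have sub: "noise_events M w e i \<subseteq> (\<Union>i\<in>J. noise_events M w e i)" if "i \<in> J" for i
    using that by blast
  show "w t \<in> borel_measurable (noise_algebra M w e J)" if "Inl t \<in> J"
    unfolding noise_algebra_def using sub[OF that]
    by (intro measurable_sigma_preimages[OF Pow]) (simp add: noise_events_def)
  show "e t \<in> borel_measurable (noise_algebra M w e J)" if "Inr t \<in> J"
    unfolding noise_algebra_def using sub[OF that]
    by (intro measurable_sigma_preimages[OF Pow]) (simp add: noise_events_def)
qed

lemma (in prob_space) product_law_noises:
  assumes "indep_noises M N w e" "J1 \<subseteq> {..<N} <+> {..<N}" "J2 \<subseteq> {..<N} <+> {..<N}" "J1 \<inter> J2 = {}"
    and "X \<in> measurable (noise_algebra M w e J1) S" "Y \<in> measurable (noise_algebra M w e J2) T"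
  shows "random_variable S X" "random_variable T Y"
    and "distr M S X \<Otimes>\<^sub>M distr M T Y = distr M (S \<Otimes>\<^sub>M T) (\<lambda>\<omega>. (X \<omega>, Y \<omega>))"
proof -
  have "indep_sets (noise_events M w e) ({..<N} <+> {..<N})"
    using assms(1) by (simp only: indep_noises_def noise_events_def)
  note law = product_law_sub_algebras[OF this Int_stable_noise_events assms(2-4)
      assms(5,6)[unfolded noise_algebra_def]]
  show "random_variable S X" "random_variable T Y"
    and "distr M S X \<Otimes>\<^sub>M distr M T Y = distr M (S \<Otimes>\<^sub>M T) (\<lambda>\<omega>. (X \<omega>, Y \<omega>))"
    by (rule law)+
qed

section \<open>Measurability of the closed loop\<close>

text \<open>
The state at time \<open>j\<close> only involves noises with index below \<open>j\<close>. The target algebra \<open>F\<close>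
is left abstract so that it can be the algebra of the noises before time \<open>k\<close>, which is
independent of the noises at time \<open>k\<close>.
\<close>

lemma measurable_state:
  assumes adm: "admissible N \<pi>" and "k \<le> N"
    and e: "\<And>i. i < k \<Longrightarrow> e i \<in> borel_measurable F"
    and w: "\<And>i. i < k \<Longrightarrow> w i \<in> borel_measurable F"
  shows "j \<le> k \<Longrightarrow> (\<lambda>\<omega>. state A B \<pi> (\<lambda>i. e i \<omega>) (\<lambda>i. w i \<omega>) t h j) \<in> borel_measurable F"
proof (induction j rule: less_induct)
  case (less j)
  show ?case
  proof (cases j)
    case 0
    then show ?thesis by simp
  next
    case (Suc i)
    have [measurable]: "\<pi> i \<in> measurable (PiM {..i} (\<lambda>_. borel)) borel"
        "e i \<in> borel_measurable F" "w i \<in> borel_measurable F"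
      using adm \<open>k \<le> N\<close> less.prems Suc e w by (auto simp: admissible_def)
    have state[measurable]: "(\<lambda>\<omega>. state A B \<pi> (\<lambda>i. e i \<omega>) (\<lambda>i. w i \<omega>) t h l) \<in> borel_measurable F"
      if "l \<le> i" for l
      using less.IH[of l] less.prems Suc that by simp
    have [measurable]: "(\<lambda>\<omega>. \<lambda>l\<in>{..i}. state A B \<pi> (\<lambda>i. e i \<omega>) (\<lambda>i. w i \<omega>) t h l)
        \<in> measurable F (PiM {..i} (\<lambda>_. borel))"
      by (intro measurable_restrict state) simp
    have [measurable]: "(\<lambda>\<omega>. state A B \<pi> (\<lambda>i. e i \<omega>) (\<lambda>i. w i \<omega>) t h i) \<in> borel_measurable F"
      by (rule state) simp
    show ?thesis
      unfolding Suc by (cases "Suc i \<le> t") simp_all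
  qed
qed

lemma measurable_nominal_input:
  assumes adm: "admissible N \<pi>" and k: "k < N"
    and e: "\<And>i. i < k \<Longrightarrow> e i \<in> borel_measurable F"
    and w: "\<And>i. i < k \<Longrightarrow> w i \<in> borel_measurable F"
    and j: "j \<le> k"
  shows "(\<lambda>\<omega>. \<pi> j (\<lambda>i\<in>{..j}. state A B \<pi> (\<lambda>i. e i \<omega>) (\<lambda>i. w i \<omega>) t h i)) \<in> borel_measurable F"
proof -
  have [measurable]: "\<pi> j \<in> measurable (PiM {..j} (\<lambda>_. borel)) borel"
    using adm k j by (auto simp: admissible_def)
  have [measurable]: "(\<lambda>\<omega>. \<lambda>i\<in>{..j}. state A B \<pi> (\<lambda>i. e i \<omega>) (\<lambda>i. w i \<omega>) t h i)
      \<in> measurable F (PiM {..j} (\<lambda>_. borel))"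
    by (intro measurable_restrict measurable_state[OF adm less_imp_le[OF k] e w]) (use j in auto)
  show ?thesis by measurable
qed

section \<open>The entropic risk\<close>

lemma log_ennreal_mono:
  assumes "a \<le> b"
  shows "log_ennreal a \<le> log_ennreal b"
proof (cases "a = 0 \<or> b = \<infinity>")
  case True
  then show ?thesis by (auto simp: log_ennreal_def)
next
  case False
  then have "0 < enn2real a" "enn2real a \<le> enn2real b" "a \<noteq> \<infinity>" "b \<noteq> 0"
    using assms by (auto simp: enn2real_positive_iff less_top zero_less_iff_neq_zero top_unique
        intro!: enn2real_mono intro: le_less_trans)
  then show ?thesis
    using False by (simp add: log_ennreal_def)
qed

text \<open>
For negative \<open>\<theta>\<close> a larger expectation means a smaller risk; the disjunction has the
shape in which the bounds on exponential costs are proved below, so that both signs are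
treated together.
\<close>

lemma log_risk_mono:
  assumes "0 < \<theta> \<and> a \<le> b \<or> \<theta> < 0 \<and> b \<le> a"
  shows "log_risk \<theta> a \<le> log_risk \<theta> b"
  using assms
proof
  assume *: "0 < \<theta> \<and> a \<le> b"
  then show ?thesis
    unfolding log_risk_def by (intro ereal_mult_left_mono log_ennreal_mono) auto
next
  assume *: "\<theta> < 0 \<and> b \<le> a"
  have "ereal (1 / \<theta>) * y = - (ereal (- 1 / \<theta>) * y)" for y
    by (cases y) (use * in auto)
  moreover have "ereal (- 1 / \<theta>) * log_ennreal b \<le> ereal (- 1 / \<theta>) * log_ennreal a"
    using * by (intro ereal_mult_left_mono log_ennreal_mono) (auto simp: divide_nonneg_neg)
  ultimately show ?thesis
    unfolding log_risk_def by simp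
qed

lemma log_risk_exp: "\<theta> \<noteq> 0 \<Longrightarrow> log_risk \<theta> (ennreal (exp (\<theta> * v))) = ereal v"
  by (simp add: log_risk_def log_ennreal_def)

lemma admissible_feedback_policy: "admissible N (feedback_policy K)"
  unfolding admissible_def feedback_policy_def by measurable

lemma state_prescribed: "k \<le> t \<Longrightarrow> state A B \<pi> e w t h k = h k"
  by (cases k) auto

lemma distr_gaussian:
  assumes "has_gaussian_law M X 0 C"
  shows "distr M borel X = density lborel (\<lambda>x. ennreal (gaussian_density 0 C x))"
proof -
  have "distr M borel X = distr M lborel X" by (rule distr_cong) auto
  then show ?thesis using assms by (simp add: has_gaussian_law_def distributed_def)
qed

lemma borel_measurable_gaussian_density [measurable]: "gaussian_density 0 C \<in> borel_measurable borel"
  unfolding gaussian_density_def[abs_def] by measurable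

section \<open>Verification along the trajectory\<close>

locale risk_sensitive_lqr = prob_space M
  for M :: "'a measure" +
  fixes N :: nat and \<theta> :: real
    and A W Q P S Pt :: "nat \<Rightarrow> real^'n^'n"
    and B :: "nat \<Rightarrow> real^'m^'n"
    and \<Sigma> R H \<Xi> :: "nat \<Rightarrow> real^'m^'m"
    and K :: "nat \<Rightarrow> real^'n^'m"
    and \<eta> \<eta>bar :: "nat \<Rightarrow> real"
    and w :: "nat \<Rightarrow> 'a \<Rightarrow> real^'n"
    and e :: "nat \<Rightarrow> 'a \<Rightarrow> real^'m"
  assumes \<theta>: "\<theta> \<noteq> 0"
    and W: "\<And>t. t < N \<Longrightarrow> pos_def (W t)"
    and \<Sigma>: "\<And>t. t < N \<Longrightarrow> pos_def (\<Sigma> t)"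
    and R: "\<And>t. t < N \<Longrightarrow> pos_def (R t)"
    and Q: "\<And>t. t \<le> N \<Longrightarrow> pos_semidef (Q t)"
    and law_w: "\<And>t. t < N \<Longrightarrow> has_gaussian_law M (w t) 0 (W t)"
    and law_e: "\<And>t. t < N \<Longrightarrow> has_gaussian_law M (e t) 0 (\<Sigma> t)"
    and indep: "indep_noises M N w e"
    and riccati: "riccati_recursion N \<theta> A B W Q R P \<eta> S Pt H"
    and S_pos: "\<And>t. t < N \<Longrightarrow> pos_def (S t)"
    and \<Xi>: "\<And>t. t < N \<Longrightarrow> \<Xi> t = matrix_inv (\<Sigma> t) - (2 * \<theta>) *\<^sub>R H t"
    and \<Xi>_pos: "\<And>t. t < N \<Longrightarrow> pos_def (\<Xi> t)"
    and K: "\<And>t. t < N \<Longrightarrow> K t = - (matrix_inv (R t + transpose (B t) ** Pt (Suc t) ** B t)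
                                 ** transpose (B t) ** Pt (Suc t) ** A t)"
    and \<eta>bar_end: "\<eta>bar N = 0"
    and \<eta>bar: "\<And>t. t < N \<Longrightarrow> \<eta>bar t = \<eta>bar (Suc t)
           - 1 / (2 * \<theta>) * ln (det (S t ** W t) * det (\<Xi> t ** \<Sigma> t))"
begin

lemma riccati_step:
  assumes "t < N"
  shows "S t = matrix_inv (W t) - (2 * \<theta>) *\<^sub>R P (Suc t)"
    and "Pt (Suc t) = risk_adjusted \<theta> (S t) (P (Suc t))"
    and "H t = R t + transpose (B t) ** Pt (Suc t) ** B t"
    and "P t = Q t + transpose (A t) ** Pt (Suc t) ** A t
              - transpose (A t) ** Pt (Suc t) ** B t ** matrix_inv (H t)
                ** transpose (B t) ** Pt (Suc t) ** A t"
  using riccati assms unfolding riccati_recursion_def risk_adjusted_def by blast+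

lemma pos_semidef_Pt:
  assumes "t < N" "pos_semidef (P (Suc t))"
  shows "pos_semidef (Pt (Suc t))"
  unfolding riccati_step(2)[OF assms(1)]
  using pos_def_matrix_inv[OF W[OF assms(1)]] assms(2) riccati_step(1)[OF assms(1)]
    S_pos[OF assms(1)] \<theta>
  by (rule pos_semidef_risk_adjusted)

text \<open>
Positivity of \<open>H\<close> is what the Gaussian formula for the injected noise and the sign of
the penalty rest on; positivity of \<open>P\<close> carries the backward induction.
\<close>

lemma riccati_step_pos:
  assumes t: "t < N" and "pos_semidef (P (Suc t))"
  shows "pos_def (H t)" "pos_semidef (P t)"
proof -
  have Q: "pos_semidef (Q t)" using t by (intro Q) simp
  show "pos_def (H t)" "pos_semidef (P t)"
    using pos_semidef_riccati_step[OF pos_semidef_Pt[OF assms] Q R[OF t]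
        riccati_step(3)[OF t] riccati_step(4)[OF t]] by blast+
qed

lemma pos_semidef_P: "t \<le> N \<Longrightarrow> pos_semidef (P t)"
proof (induction rule: inc_induct)
  case base
  then show ?case using riccati Q[of N] by (simp add: riccati_recursion_def)
next
  case (step t)
  then show ?case using riccati_step_pos by blast
qed

text \<open>
The price of deviating from the feedback: a deviation \<open>z\<close> multiplies the expected
exponential cost by \<open>exp (\<theta> * (z \<bullet> (penalty t *v z)))\<close>. It is \<open>H t\<close>, adjusted for the
injected input noise.
\<close>

definition penalty :: "nat \<Rightarrow> real^'m^'m" where
  "penalty t = risk_adjusted \<theta> (\<Xi> t) (H t)"

lemma pos_semidef_penalty:
  assumes t: "t < N"
  shows "pos_semidef (penalty t)"
proof -
  have "pos_def (H t)"
    using riccati_step_pos(1)[OF t] pos_semidef_P[of "Suc t"] t by simp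
  then show ?thesis
    unfolding penalty_def
    using pos_def_matrix_inv[OF \<Sigma>[OF t]] pos_semidef_if_pos_def \<Xi>[OF t] \<Xi>_pos[OF t] \<theta>
    by (intro pos_semidef_risk_adjusted)
qed

definition traj :: "('n, 'm) policy \<Rightarrow> nat \<Rightarrow> (nat \<Rightarrow> real^'n) \<Rightarrow> 'a \<Rightarrow> nat \<Rightarrow> real^'n" where
  "traj \<pi> t h \<omega> = state A B \<pi> (\<lambda>i. e i \<omega>) (\<lambda>i. w i \<omega>) t h"

definition nominal :: "('n, 'm) policy \<Rightarrow> nat \<Rightarrow> (nat \<Rightarrow> real^'n) \<Rightarrow> 'a \<Rightarrow> nat \<Rightarrow> real^'m" where
  "nominal \<pi> t h \<omega> k = \<pi> k (\<lambda>i\<in>{..k}. traj \<pi> t h \<omega> i)"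

definition stage_cost :: "nat \<Rightarrow> real^'n \<Rightarrow> real^'m \<Rightarrow> real" where
  "stage_cost k x u = x \<bullet> (Q k *v x) + u \<bullet> (R k *v u)"

definition accumulated :: "('n, 'm) policy \<Rightarrow> nat \<Rightarrow> (nat \<Rightarrow> real^'n) \<Rightarrow> 'a \<Rightarrow> nat \<Rightarrow> real" where
  "accumulated \<pi> t h \<omega> k = (\<Sum>j=t..<k. stage_cost j (traj \<pi> t h \<omega> j) (nominal \<pi> t h \<omega> j + e j \<omega>))"

definition value_function :: "nat \<Rightarrow> real^'n \<Rightarrow> real" where
  "value_function k x = x \<bullet> (P k *v x) + \<eta>bar k"

text \<open>
It starts at \<open>k = t\<close> as the exponential of \<open>\<theta>\<close> times the conjectured optimum and ends at
\<open>k = N\<close> as the expected exponential cost of the policy; the whole proof is about its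
monotonicity in \<open>k\<close>.
\<close>

definition exp_value :: "('n, 'm) policy \<Rightarrow> nat \<Rightarrow> (nat \<Rightarrow> real^'n) \<Rightarrow> nat \<Rightarrow> ennreal" where
  "exp_value \<pi> t h k =
    (\<integral>\<^sup>+\<omega>. ennreal (exp (\<theta> * (accumulated \<pi> t h \<omega> k + value_function k (traj \<pi> t h \<omega> k)))) \<partial>M)"

text \<open>
The one-step Gaussian computation for the law of the actual noise pair at time \<open>k\<close>. The
constant \<open>c\<close> is the cost accumulated so far.
\<close>

lemma noise_step_integral:
  assumes k: "k < N"
  shows "(\<integral>\<^sup>+y. ennreal (exp (\<theta> * (c + (stage_cost k x (v + fst y) +
        value_function (Suc k) (A k *v x + B k *v (v + fst y) + snd y))))) \<partial>distr M (borel \<Otimes>\<^sub>M borel) (\<lambda>\<omega>. (e k \<omega>, w k \<omega>)))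
    = ennreal (exp (\<theta> * (c + value_function k x)) * exp (\<theta> * ((v - K k *v x) \<bullet> (penalty k *v (v - K k *v x)))))"
    (is "?I = _")
proof -
  define f where "f a b = ennreal (exp (\<theta> * (stage_cost k x (v + a) +
        value_function (Suc k) (A k *v x + B k *v (v + a) + b))))" for a b
  have [measurable]: "(\<lambda>y. f (fst y) (snd y)) \<in> borel_measurable (borel \<Otimes>\<^sub>M borel)"
    unfolding f_def stage_cost_def value_function_def by measurable
  have [measurable]: "(\<lambda>b. f a b) \<in> borel_measurable borel" for a
    unfolding f_def value_function_def by measurable
  have noise: "e k \<in> borel_measurable (noise_algebra M w e {Inr k})"
      "w k \<in> borel_measurable (noise_algebra M w e {Inl k})"
    by (auto intro: measurable_noise_algebra)
  have "{Inr k} \<subseteq> {..<N} <+> {..<N}" "{Inl k} \<subseteq> {..<N} <+> {..<N}" "{Inr k} \<inter> {Inl k} = {}"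
    using k by auto
  note law = product_law_noises[OF indep this noise]
  note [measurable] = law(1,2) and joint = law(3)[symmetric]
  interpret w: prob_space "distr M borel (w k)" by (rule prob_space_distr) simp
  have meas: "(\<lambda>y. f (fst y) (snd y)) \<in> borel_measurable (distr M borel (e k) \<Otimes>\<^sub>M distr M borel (w k))"
    by (simp cong: measurable_cong_sets sets_pair_measure_cong)
  have "exp (\<theta> * (c + d)) = exp (\<theta> * c) * exp (\<theta> * d)" for d
    by (simp add: distrib_left exp_add)
  then have "?I = (\<integral>\<^sup>+y. ennreal (exp (\<theta> * c)) * f (fst y) (snd y) \<partial>(distr M borel (e k) \<Otimes>\<^sub>M distr M borel (w k)))"
    unfolding joint f_def by (simp add: ennreal_mult'')
  also have "\<dots> = ennreal (exp (\<theta> * c)) *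
      (\<integral>\<^sup>+y. f (fst y) (snd y) \<partial>(distr M borel (e k) \<Otimes>\<^sub>M distr M borel (w k)))"
    by (rule nn_integral_cmult[OF meas])
  also have "(\<integral>\<^sup>+y. f (fst y) (snd y) \<partial>(distr M borel (e k) \<Otimes>\<^sub>M distr M borel (w k)))
      = (\<integral>\<^sup>+a. (\<integral>\<^sup>+b. f a b \<partial>distr M borel (w k)) \<partial>distr M borel (e k))"
    using w.nn_integral_fst[OF meas] by simp
  also have "\<dots> = (\<integral>\<^sup>+a. ennreal (gaussian_density 0 (\<Sigma> k) a) *
      (\<integral>\<^sup>+b. ennreal (gaussian_density 0 (W k) b) * f a b \<partial>lborel) \<partial>lborel)"
  proof -
    have "(\<lambda>a. \<integral>\<^sup>+b. f a b \<partial>distr M borel (w k)) \<in> borel_measurable (distr M borel (e k))"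
      using w.borel_measurable_nn_integral_fst[OF meas] by simp
    then have [measurable]: "(\<lambda>a. \<integral>\<^sup>+b. f a b \<partial>distr M borel (w k)) \<in> borel_measurable borel"
      by simp
    show ?thesis
      unfolding distr_gaussian[OF law_e[OF k]]
      by (subst nn_integral_density)
        (simp_all add: distr_gaussian[OF law_w[OF k]] nn_integral_density)
  qed
  also have "\<dots> = ennreal (exp (\<theta> * (x \<bullet> (P k *v x) + \<eta>bar k)) *
        exp (\<theta> * ((v - K k *v x) \<bullet> (penalty k *v (v - K k *v x)))))"
    unfolding f_def stage_cost_def value_function_def penalty_def
    using gaussian_control_step[OF \<theta> W[OF k] \<Sigma>[OF k] R[OF k] pos_semidef_P[of "Suc k"] Q[of k]
        riccati_step(1)[OF k] S_pos[OF k]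
        riccati_step(3)[OF k, unfolded riccati_step(2)[OF k]] \<Xi>[OF k] \<Xi>_pos[OF k]
        K[OF k, folded riccati_step(3)[OF k], unfolded riccati_step(2)[OF k]]
        riccati_step(4)[OF k, unfolded riccati_step(2)[OF k]] \<eta>bar[OF k], of x v] k
    by (simp add: add.assoc)
  finally show ?thesis
    by (simp add: value_function_def ennreal_mult''[symmetric] ennreal_mult'[symmetric] distrib_left exp_add mult.assoc)
qed

text \<open>
The triple carries everything about the past on which the next value depends: with it
frozen, the next value is a function of the fresh noise pair alone.
\<close>

lemma measurable_past_data:
  assumes adm: "admissible N \<pi>" and k: "k < N"
    and e[measurable]: "\<And>i. i < k \<Longrightarrow> e i \<in> borel_measurable F"
    and w: "\<And>i. i < k \<Longrightarrow> w i \<in> borel_measurable F"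
  shows "(\<lambda>\<omega>. (accumulated \<pi> t h \<omega> k, nominal \<pi> t h \<omega> k, traj \<pi> t h \<omega> k))
    \<in> measurable F (borel \<Otimes>\<^sub>M borel \<Otimes>\<^sub>M borel)"
proof -
  have traj[measurable]: "(\<lambda>\<omega>. traj \<pi> t h \<omega> j) \<in> borel_measurable F" if "j \<le> k" for j
    unfolding traj_def by (rule measurable_state[OF adm less_imp_le[OF k] e w that])
  have nominal[measurable]: "(\<lambda>\<omega>. nominal \<pi> t h \<omega> j) \<in> borel_measurable F" if "j \<le> k" for j
    unfolding nominal_def traj_def by (rule measurable_nominal_input[OF adm k e w that])
  have "(\<lambda>\<omega>. stage_cost j (traj \<pi> t h \<omega> j) (nominal \<pi> t h \<omega> j + e j \<omega>)) \<in> borel_measurable F"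
    if "j \<in> {t..<k}" for j
  proof -
    have [measurable]: "(\<lambda>\<omega>. traj \<pi> t h \<omega> j) \<in> borel_measurable F"
        "(\<lambda>\<omega>. nominal \<pi> t h \<omega> j) \<in> borel_measurable F" "e j \<in> borel_measurable F"
      using that traj[of j] nominal[of j] e[of j] by auto
    show ?thesis unfolding stage_cost_def by measurable
  qed
  then have [measurable]: "(\<lambda>\<omega>. accumulated \<pi> t h \<omega> k) \<in> borel_measurable F"
    unfolding accumulated_def by (rule borel_measurable_sum)
  have [measurable]: "(\<lambda>\<omega>. traj \<pi> t h \<omega> k) \<in> borel_measurable F"
      "(\<lambda>\<omega>. nominal \<pi> t h \<omega> k) \<in> borel_measurable F"
    using traj[of k] nominal[of k] by auto
  show ?thesis by measurable
qed

text \<open>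
The heart of the argument: freeze the past, which is independent of \<open>(e k, w k)\<close>, and
integrate the fresh pair by \<open>noise_step_integral\<close>.
\<close>

lemma exp_value_step:
  fixes h :: "nat \<Rightarrow> real^'n"
  assumes adm: "admissible N \<pi>" and k: "t \<le> k" "k < N"
  defines "z \<omega> \<equiv> nominal \<pi> t h \<omega> k - K k *v traj \<pi> t h \<omega> k"
  shows "exp_value \<pi> t h (Suc k) = (\<integral>\<^sup>+\<omega>. ennreal (exp (\<theta> * (accumulated \<pi> t h \<omega> k + value_function k (traj \<pi> t h \<omega> k)))
      * exp (\<theta> * (z \<omega> \<bullet> (penalty k *v z \<omega>)))) \<partial>M)"
proof -
  define X where "X \<omega> = (accumulated \<pi> t h \<omega> k, nominal \<pi> t h \<omega> k, traj \<pi> t h \<omega> k)" for \<omega>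
  define Y where "Y \<omega> = (e k \<omega>, w k \<omega>)" for \<omega>
  define f where "f p = ennreal (exp (\<theta> * (fst (fst p) + (stage_cost k (snd (snd (fst p)))
      (fst (snd (fst p)) + fst (snd p)) + value_function (Suc k) (A k *v snd (snd (fst p))
        + B k *v (fst (snd (fst p)) + fst (snd p)) + snd (snd p))))))"
    for p :: "(real \<times> (real^'m) \<times> (real^'n)) \<times> (real^'m) \<times> (real^'n)"
  have f: "f \<in> borel_measurable ((borel \<Otimes>\<^sub>M borel \<Otimes>\<^sub>M borel) \<Otimes>\<^sub>M (borel \<Otimes>\<^sub>M borel))"
    unfolding f_def[abs_def] stage_cost_def value_function_def by measurable
  have X: "X \<in> measurable (noise_algebra M w e ({..<k} <+> {..<k})) (borel \<Otimes>\<^sub>M borel \<Otimes>\<^sub>M borel)"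
    unfolding X_def[abs_def]
    by (rule measurable_past_data[OF adm k(2)]) (auto intro!: measurable_noise_algebra)
  have Y: "Y \<in> measurable (noise_algebra M w e ({k} <+> {k})) (borel \<Otimes>\<^sub>M borel)"
    unfolding Y_def[abs_def]
    by (intro measurable_Pair measurable_noise_algebra) auto
  have "{..<k} <+> {..<k} \<subseteq> {..<N} <+> {..<N}" "{k} <+> {k} \<subseteq> {..<N} <+> {..<N}"
      "({..<k} <+> {..<k}) \<inter> ({k} <+> {k}) = {}"
    using k(2) by auto
  note law = product_law_noises[OF indep this X Y]
  have "(\<integral>\<^sup>+\<omega>. f (X \<omega>, Y \<omega>) \<partial>M) = (\<integral>\<^sup>+\<omega>. (\<integral>\<^sup>+y. f (X \<omega>, y) \<partial>distr M (borel \<Otimes>\<^sub>M borel) Y) \<partial>M)"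
    by (rule nn_integral_product_law[OF law f])
  also have "\<dots> = (\<integral>\<^sup>+\<omega>. ennreal (exp (\<theta> * (accumulated \<pi> t h \<omega> k + value_function k (traj \<pi> t h \<omega> k)))
      * exp (\<theta> * (z \<omega> \<bullet> (penalty k *v z \<omega>)))) \<partial>M)"
    unfolding f_def X_def Y_def[abs_def] z_def fst_conv snd_conv noise_step_integral[OF k(2)] ..
  also have "(\<integral>\<^sup>+\<omega>. f (X \<omega>, Y \<omega>) \<partial>M) = exp_value \<pi> t h (Suc k)"
  proof -
    have "traj \<pi> t h \<omega> (Suc k) = A k *v traj \<pi> t h \<omega> k + B k *v (nominal \<pi> t h \<omega> k + e k \<omega>) + w k \<omega>" for \<omega>
      using k(1) by (simp add: traj_def nominal_def)
    then show ?thesis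
      using k(1) by (simp add: exp_value_def f_def X_def Y_def accumulated_def add.assoc)
  qed
  finally show ?thesis .
qed

lemma exp_value_start: "exp_value \<pi> t h t = ennreal (exp (\<theta> * value_function t (h t)))"
  by (simp add: exp_value_def accumulated_def traj_def state_prescribed emeasure_space_1)

lemma exp_value_end:
  shows "exp_value \<pi> t h N = exp_cost M N \<theta> A B Q R w e t h \<pi>"
proof -
  have "P N = Q N" using riccati by (simp add: riccati_recursion_def)
  then show ?thesis
    by (simp add: exp_value_def exp_cost_def cost_from_def accumulated_def stage_cost_def value_function_def
        \<eta>bar_end input_def traj_def nominal_def add.commute)
qed

text \<open>
The factor by which the integrand changes is at least or at most \<open>1\<close> according to the
sign of \<open>\<theta>\<close>, since the penalty is positive semidefinite. The integrals may be infinite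
for \<open>\<theta> > 0\<close>; the comparison is pointwise and unaffected.
\<close>

lemma exp_value_monotone:
  assumes adm: "admissible N \<pi>" and k: "t \<le> k" "k < N"
  shows "0 < \<theta> \<Longrightarrow> exp_value \<pi> t h k \<le> exp_value \<pi> t h (Suc k)"
    and "\<theta> < 0 \<Longrightarrow> exp_value \<pi> t h (Suc k) \<le> exp_value \<pi> t h k"
proof -
  define z where "z \<omega> = nominal \<pi> t h \<omega> k - K k *v traj \<pi> t h \<omega> k" for \<omega>
  define V where "V \<omega> = exp (\<theta> * (accumulated \<pi> t h \<omega> k + value_function k (traj \<pi> t h \<omega> k)))" for \<omega>
  define r where "r \<omega> = z \<omega> \<bullet> (penalty k *v z \<omega>)" for \<omega>
  have r: "0 \<le> r \<omega>" for \<omega>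
    using pos_semidef_penalty[OF k(2)] by (simp add: pos_semidef_def r_def)
  have V: "exp_value \<pi> t h k = (\<integral>\<^sup>+\<omega>. ennreal (V \<omega>) \<partial>M)"
    by (simp add: exp_value_def V_def)
  have V': "exp_value \<pi> t h (Suc k) = (\<integral>\<^sup>+\<omega>. ennreal (V \<omega> * exp (\<theta> * r \<omega>)) \<partial>M)"
    unfolding exp_value_step[OF adm k] V_def r_def z_def ..
  show "exp_value \<pi> t h k \<le> exp_value \<pi> t h (Suc k)" if "0 < \<theta>"
    unfolding V V'
  proof (intro nn_integral_mono ennreal_leI)
    fix \<omega>
    have "1 \<le> exp (\<theta> * r \<omega>)" using that r by simp
    then show "V \<omega> \<le> V \<omega> * exp (\<theta> * r \<omega>)"
      using mult_left_mono[of 1 "exp (\<theta> * r \<omega>)" "V \<omega>"] by (simp add: V_def)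
  qed
  show "exp_value \<pi> t h (Suc k) \<le> exp_value \<pi> t h k" if "\<theta> < 0"
    unfolding V V'
  proof (intro nn_integral_mono ennreal_leI)
    fix \<omega>
    have "exp (\<theta> * r \<omega>) \<le> 1" using that r by (simp add: mult_nonpos_nonneg)
    then show "V \<omega> * exp (\<theta> * r \<omega>) \<le> V \<omega>"
      using mult_left_mono[of "exp (\<theta> * r \<omega>)" 1 "V \<omega>"] by (simp add: V_def)
  qed
qed

lemma exp_cost_bound:
  assumes adm: "admissible N \<pi>" and t: "t \<le> N"
  shows "0 < \<theta> \<and> ennreal (exp (\<theta> * value_function t (h t))) \<le> exp_cost M N \<theta> A B Q R w e t h \<pi>
    \<or> \<theta> < 0 \<and> exp_cost M N \<theta> A B Q R w e t h \<pi> \<le> ennreal (exp (\<theta> * value_function t (h t)))"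
proof -
  have "k \<le> N \<longrightarrow> (0 < \<theta> \<and> exp_value \<pi> t h t \<le> exp_value \<pi> t h k
    \<or> \<theta> < 0 \<and> exp_value \<pi> t h k \<le> exp_value \<pi> t h t)" if "t \<le> k" for k
    using that
  proof (induction rule: dec_induct)
    case base
    then show ?case using \<theta> by auto
  next
    case (step k)
    then show ?case
      using exp_value_monotone[OF adm \<open>t \<le> k\<close>, of h] by (auto intro: order_trans)
  qed
  from this[OF t] show ?thesis
    by (simp add: exp_value_start exp_value_end)
qed

lemma exp_cost_feedback:
  assumes t: "t \<le> N"
  shows "exp_cost M N \<theta> A B Q R w e t h (feedback_policy K) = ennreal (exp (\<theta> * value_function t (h t)))"
proof -
  have "k \<le> N \<longrightarrow> exp_value (feedback_policy K) t h k = exp_value (feedback_policy K) t h t" if "t \<le> k" for k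
    using that
  proof (induction rule: dec_induct)
    case (step k)
    have "nominal (feedback_policy K) t h \<omega> k = K k *v traj (feedback_policy K) t h \<omega> k" for \<omega>
      by (simp add: nominal_def feedback_policy_def)
    then have "exp_value (feedback_policy K) t h (Suc k) = exp_value (feedback_policy K) t h k" if "k < N"
      using exp_value_step[OF admissible_feedback_policy \<open>t \<le> k\<close> that, of K h]
      by (simp add: exp_value_def)
    with step show ?case by simp
  qed simp
  from this[OF t] show ?thesis
    by (simp add: exp_value_start exp_value_end)
qed

lemma total_risk_optimal:
  "is_arg_min (total_risk M N \<theta> A B Q R w e xini) (admissible N) (feedback_policy K)"
proof -
  have "total_risk M N \<theta> A B Q R w e xini (feedback_policy K) \<le> total_risk M N \<theta> A B Q R w e xini \<pi>"
    if "admissible N \<pi>" for \<pi>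
    unfolding total_risk_def exp_cost_feedback[OF le0]
    by (rule log_risk_mono) (rule exp_cost_bound[OF that le0])
  then show ?thesis
    by (auto simp: is_arg_min_def admissible_feedback_policy not_less)
qed

text \<open>
The bound on the exponential cost is the same for all pasts \<open>h\<close> with current state \<open>x\<close>,
so it survives averaging over any law \<open>\<nu>\<close> of the past: remembering earlier states is of
no use.
\<close>

lemma risk_to_go_bound:
  assumes t: "t \<le> N" and \<nu>: "past_law t \<nu>"
  shows "admissible N \<pi> \<Longrightarrow> ereal (value_function t x) \<le> risk_to_go M N \<theta> A B Q R w e t \<nu> x \<pi>"
    and "risk_to_go M N \<theta> A B Q R w e t \<nu> x (feedback_policy K) = ereal (value_function t x)"
proof -
  interpret \<nu>: prob_space \<nu> using \<nu> by (simp add: past_law_def)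
  have const: "(\<integral>\<^sup>+h. ennreal (exp (\<theta> * value_function t x)) \<partial>\<nu>) = ennreal (exp (\<theta> * value_function t x))"
    using \<nu>.emeasure_space_1 by simp
  show "risk_to_go M N \<theta> A B Q R w e t \<nu> x (feedback_policy K) = ereal (value_function t x)"
    unfolding risk_to_go_def exp_cost_feedback[OF t] fun_upd_same const by (rule log_risk_exp[OF \<theta>])
  show "ereal (value_function t x) \<le> risk_to_go M N \<theta> A B Q R w e t \<nu> x \<pi>" if adm: "admissible N \<pi>"
  proof -
    have bound: "0 < \<theta> \<and> ennreal (exp (\<theta> * value_function t x)) \<le> exp_cost M N \<theta> A B Q R w e t (h(t := x)) \<pi>
      \<or> \<theta> < 0 \<and> exp_cost M N \<theta> A B Q R w e t (h(t := x)) \<pi> \<le> ennreal (exp (\<theta> * value_function t x))" for h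
      using exp_cost_bound[OF adm t, of "h(t := x)"] by simp
    have "log_risk \<theta> (\<integral>\<^sup>+h. ennreal (exp (\<theta> * value_function t x)) \<partial>\<nu>)
        \<le> risk_to_go M N \<theta> A B Q R w e t \<nu> x \<pi>"
      unfolding risk_to_go_def
    proof (rule log_risk_mono, cases "0 < \<theta>")
      case True
      then show "0 < \<theta> \<and> (\<integral>\<^sup>+h. ennreal (exp (\<theta> * value_function t x)) \<partial>\<nu>)
          \<le> (\<integral>\<^sup>+h. exp_cost M N \<theta> A B Q R w e t (h(t := x)) \<pi> \<partial>\<nu>)
        \<or> \<theta> < 0 \<and> (\<integral>\<^sup>+h. exp_cost M N \<theta> A B Q R w e t (h(t := x)) \<pi> \<partial>\<nu>)
          \<le> (\<integral>\<^sup>+h. ennreal (exp (\<theta> * value_function t x)) \<partial>\<nu>)"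
        using bound by (intro disjI1 conjI nn_integral_mono) auto
    next
      case False
      then show "0 < \<theta> \<and> (\<integral>\<^sup>+h. ennreal (exp (\<theta> * value_function t x)) \<partial>\<nu>)
          \<le> (\<integral>\<^sup>+h. exp_cost M N \<theta> A B Q R w e t (h(t := x)) \<pi> \<partial>\<nu>)
        \<or> \<theta> < 0 \<and> (\<integral>\<^sup>+h. exp_cost M N \<theta> A B Q R w e t (h(t := x)) \<pi> \<partial>\<nu>)
          \<le> (\<integral>\<^sup>+h. ennreal (exp (\<theta> * value_function t x)) \<partial>\<nu>)"
        using bound \<theta> by (intro disjI2 conjI nn_integral_mono) auto
    qed
    then show ?thesis
      unfolding const log_risk_exp[OF \<theta>] .
  qed
qed

lemma cost_to_go_eq:
  assumes t: "t \<le> N" and \<nu>: "past_law t \<nu>"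
  shows "cost_to_go M N \<theta> A B Q R w e t \<nu> x = ereal (value_function t x)"
proof (cases "t = N")
  case True
  then show ?thesis
    using riccati by (simp add: cost_to_go_def value_function_def \<eta>bar_end riccati_recursion_def)
next
  case False
  have "(INF \<pi>\<in>Collect (admissible N). risk_to_go M N \<theta> A B Q R w e t \<nu> x \<pi>) = ereal (value_function t x)"
  proof (rule antisym)
    show "(INF \<pi>\<in>Collect (admissible N). risk_to_go M N \<theta> A B Q R w e t \<nu> x \<pi>) \<le> ereal (value_function t x)"
      using risk_to_go_bound(2)[OF t \<nu>, of x] admissible_feedback_policy[of N K]
      by (metis INF_lower mem_Collect_eq)
    show "ereal (value_function t x) \<le> (INF \<pi>\<in>Collect (admissible N). risk_to_go M N \<theta> A B Q R w e t \<nu> x \<pi>)"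
      using risk_to_go_bound(1)[OF t \<nu>] by (intro INF_greatest) simp
  qed
  with False show ?thesis by (simp add: cost_to_go_def)
qed

lemma risk_to_go_optimal:
  assumes t: "t \<le> N" and \<nu>: "past_law t \<nu>"
  shows "is_arg_min (risk_to_go M N \<theta> A B Q R w e t \<nu> x) (admissible N) (feedback_policy K)"
  using risk_to_go_bound(1)[OF t \<nu>, of _ x] risk_to_go_bound(2)[OF t \<nu>, of x] admissible_feedback_policy[of N K]
  by (auto simp: is_arg_min_def not_less)

end

theorem theorem1:
  fixes M :: "'a measure"
    and N :: nat
    and \<theta> :: real
    and A W Q P S Pt :: "nat \<Rightarrow> real^'n^'n"
    and B :: "nat \<Rightarrow> real^'m^'n"
    and \<Sigma> R H \<Xi> :: "nat \<Rightarrow> real^'m^'m"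
    and K :: "nat \<Rightarrow> real^'n^'m"
    and \<eta> \<eta>bar :: "nat \<Rightarrow> real"
    and w :: "nat \<Rightarrow> 'a \<Rightarrow> real^'n"
    and e :: "nat \<Rightarrow> 'a \<Rightarrow> real^'m"
    and xini :: "real^'n"
  assumes "0 < N" and "\<theta> \<noteq> 0"
    and "\<And>t. t < N \<Longrightarrow> pos_def (W t)"
    and "\<And>t. t < N \<Longrightarrow> pos_def (\<Sigma> t)"
    and "\<And>t. t < N \<Longrightarrow> pos_def (R t)"
    and "\<And>t. t \<le> N \<Longrightarrow> pos_semidef (Q t)"
    and "prob_space M"
    and "\<And>t. t < N \<Longrightarrow> has_gaussian_law M (w t) 0 (W t)"
    and "\<And>t. t < N \<Longrightarrow> has_gaussian_law M (e t) 0 (\<Sigma> t)"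
    and "indep_noises M N w e"
    and "riccati_recursion N \<theta> A B W Q R P \<eta> S Pt H"
    and "riccati_well_defined N W S H"
    and "\<And>t. t < N \<Longrightarrow> pos_def (S t)"
    and "\<And>t. t < N \<Longrightarrow> \<Xi> t = matrix_inv (\<Sigma> t) - (2 * \<theta>) *\<^sub>R H t"
    and "\<And>t. t < N \<Longrightarrow> pos_def (\<Xi> t)"
    and "\<And>t. t < N \<Longrightarrow> K t = - (matrix_inv (R t + transpose (B t) ** Pt (Suc t) ** B t)
                                 ** transpose (B t) ** Pt (Suc t) ** A t)"
    and "\<eta>bar N = 0"
    and "\<And>t. t < N \<Longrightarrow> \<eta>bar t = \<eta>bar (Suc t)
           - 1 / (2 * \<theta>) * ln (det (S t ** W t) * det (\<Xi> t ** \<Sigma> t))"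
  shows "is_arg_min (total_risk M N \<theta> A B Q R w e xini) (admissible N) (feedback_policy K)
       \<and> (\<forall>t\<le>N. \<forall>\<nu> x. past_law t \<nu> \<longrightarrow>
            cost_to_go M N \<theta> A B Q R w e t \<nu> x = ereal (x \<bullet> (P t *v x) + \<eta>bar t)
          \<and> (\<exists>\<pi>. is_arg_min (risk_to_go M N \<theta> A B Q R w e t \<nu> x) (admissible N) \<pi>))"
proof -
  interpret risk_sensitive_lqr M N \<theta> A W Q P S Pt B \<Sigma> R H \<Xi> K \<eta> \<eta>bar w e
    using assms by (intro risk_sensitive_lqr.intro risk_sensitive_lqr_axioms.intro) auto
  show ?thesis
    using total_risk_optimal cost_to_go_eq risk_to_go_optimal unfolding value_function_def by blast
qed

end
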